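(* Suppose that $G_1$ and $G_2$ are doubled path equivalent alternating decomposition graphs. Then $g_T(G_1)=g_T(G_2)$.
   Context: Graphs are finite and may have multiple edges. A link diagram $D$ is viewed as a $4$-valent graph on the sphere $S^2$ with over/under information at the vertices (crossings). An edge of $D$ is non-alternating if both of its ends are over-strands or both are under-strands at the crossings they meet; otherwise it is alternating. A diagram is alternating if all its edges are alternating. Alternating decomposition graph of $D$: for a connected diagram $D$, mark two distinct points on every non-alternating edge, and inside each face join by disjoint arcs those pairs of marked points that are adjacent along the boundary of the face but do not lie on the same edge of $D$; the arcs form disjoint simple closed curves $\gamma_1,\dots,\gamma_m$. If $D$ is connected and alternating, its alternating decomposition graph is a single vertex. If $D$ is connected and not alternating, the graph has vertices $v_1,\dots,v_m$ corresponding to the curves and one edge for each non-alternating edge of $D$, joining $v_i$ and $v_j$ where $\gamma_i,\gamma_j$ are the curves through the two marked points. For disconnected $D$ take the disjoint union over connected components. An alternating decomposition graph is a graph arising in this way; equivalently, it is a planar bipartite graph all of whose vertices have even degree. For a link diagram $D$, $g_T(D)=\frac12\bigl(2k(D)+c(D)-s_A(D)-s_B(D)\bigr)$ is the genus of its Turaev surface, where $k(D)$ is the number of connected components of $D$ as a graph, $c(D)$ the number of crossings, and $s_A(D),s_B(D)$ the numbers of curves in the all-$A$ and all-$B$ states. For an alternating decomposition graph $G$, $g_T(G):=g_T(D)$ for any diagram $D$ with alternating decomposition graph $G$ (this is independent of $D$). A doubled path of length $k$ in $G$ consists of distinct vertices $v_0,\dots,v_k$ such that for each $i=1,\dots,k$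 there are two distinct edges $e_{i,1},e_{i,2}$ joining $v_{i-1}$ and $v_i$, and $\deg v_i=4$ for $1\le i\le k-1$. A doubled path contraction of $G$ replaces $G$ by $G/\{e_{i,1},e_{i,2}\}$ (identify $v_{i-1}$ and $v_i$ and delete $e_{i,1},e_{i,2}$) for some $i$ and some doubled path of length $k\ge 2$, so that the doubled path is shortened but not destroyed; the inverse operation is a doubled path extension. Two alternating decomposition graphs are doubled path equivalent if some finite sequence of doubled path contractions and extensions transforms one into the other (up to isomorphism); intermediate graphs need not be bipartite. *)

theory Defs
  imports Complex_Main "HOL-Combinatorics.Orbits"
begin

definition classes_of :: "'a set \<Rightarrow> ('a \<Rightarrow> 'a \<Rightarrow> bool) \<Rightarrow> 'a set set" where
  "classes_of S r = {{y \<in> S. equivclp (\<lambda>a b. a \<in> S \<and> b \<in> S \<and> r a b) x y} |x. x \<in> S}"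


section \<open>Finite multigraphs\<close>

text \<open>Undirected graphs with parallel edges. A loop is an edge with a single end vertex;
  loops are permitted, although none occur in the graphs arising from diagrams.\<close>

record ('v, 'e) mgraph =
  verts :: "'v set"
  edges :: "'e set"
  ends  :: "'e \<Rightarrow> 'v set"

definition multigraph :: "('v, 'e) mgraph \<Rightarrow> bool" where
  "multigraph G \<longleftrightarrow> finite (verts G) \<and> finite (edges G) \<and>
     (\<forall>e\<in>edges G. ends G e \<subseteq> verts G \<and> card (ends G e) \<in> {1, 2})"

definition degree :: "('v, 'e) mgraph \<Rightarrow> 'v \<Rightarrow> nat" where
  "degree G v = card {e \<in> edges G. v \<in> ends G e} + card {e \<in> edges G. ends G e = {v}}"

definition isomorphic :: "('v, 'e) mgraph \<Rightarrow> ('w, 'f) mgraph \<Rightarrow> bool" where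
  "isomorphic G H \<longleftrightarrow> (\<exists>f g. bij_betw f (verts G) (verts H) \<and> bij_betw g (edges G) (edges H) \<and>
     (\<forall>e\<in>edges G. ends H (g e) = f ` ends G e))"

text \<open>The graph G/F for a set F of edges joining x and y: y is identified with x, and
  exactly the edges of F are deleted.\<close>

definition contract :: "('v, 'e) mgraph \<Rightarrow> 'v \<Rightarrow> 'v \<Rightarrow> 'e set \<Rightarrow> ('v, 'e) mgraph" where
  "contract G x y F = \<lparr>verts = verts G - {y}, edges = edges G - F,
     ends = (\<lambda>e. (\<lambda>u. if u = y then x else u) ` ends G e)\<rparr>"

definition doubled_path ::
  "('v, 'e) mgraph \<Rightarrow> nat \<Rightarrow> (nat \<Rightarrow> 'v) \<Rightarrow> (nat \<Rightarrow> 'e) \<Rightarrow> (nat \<Rightarrow> 'e) \<Rightarrow> bool" where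
  "doubled_path G k v e1 e2 \<longleftrightarrow>
     v ` {0..k} \<subseteq> verts G \<and> inj_on v {0..k} \<and>
     (\<forall>i\<in>{1..k}. e1 i \<in> edges G \<and> e2 i \<in> edges G \<and> e1 i \<noteq> e2 i \<and>
        ends G (e1 i) = {v (i - 1), v i} \<and> ends G (e2 i) = {v (i - 1), v i}) \<and>
     (\<forall>i\<in>{1..<k}. degree G (v i) = 4)"

definition doubled_path_contraction :: "('v, 'e) mgraph \<Rightarrow> ('w, 'f) mgraph \<Rightarrow> bool" where
  "doubled_path_contraction G H \<longleftrightarrow> multigraph G \<and>
     (\<exists>k v e1 e2 i. 2 \<le> k \<and> doubled_path G k v e1 e2 \<and> i \<in> {1..k} \<and>
        isomorphic (contract G (v (i - 1)) (v i) {e1 i, e2 i}) H)"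

text \<open>The intermediate graphs live on natural numbers, which provide a representative of every
  isomorphism class of finite multigraphs; equivclp allows contractions and extensions
  in any order.\<close>

definition doubled_path_equivalent :: "('v, 'e) mgraph \<Rightarrow> ('w, 'f) mgraph \<Rightarrow> bool" where
  "doubled_path_equivalent G1 G2 \<longleftrightarrow>
     (\<exists>(H1 :: (nat, nat) mgraph) (H2 :: (nat, nat) mgraph).
        isomorphic G1 H1 \<and> equivclp doubled_path_contraction H1 H2 \<and> isomorphic H2 G2)"


section \<open>Link diagrams\<close>

text \<open>A link diagram is encoded as a combinatorial map. A dart is an end of an edge at a crossing;
  opp exchanges the two darts of an edge, and rot sends a dart to the next one
  counterclockwise around its crossing. The predicate over holds of the darts belonging to the
  over-strand. The orbits of rot are the crossings and the orbits of
  rot \<open>\<circ>\<close> opp are the faces. The elements of circles stand for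
  the components without crossings. For a disconnected diagram the faces here are those of its connected
  components, each in its own sphere; the relative position of the components is not
  recorded, as none of the notions below depends on it.\<close>

record 'd diagram =
  darts   :: "'d set"
  opp     :: "'d \<Rightarrow> 'd"
  rot     :: "'d \<Rightarrow> 'd"
  over    :: "'d \<Rightarrow> bool"
  circles :: "'d set"

definition face_step :: "'d diagram \<Rightarrow> 'd \<Rightarrow> 'd" where
  "face_step D d = rot D (opp D d)"

text \<open>Connected components, apart from the crossingless circles.\<close>

definition crossing_components :: "'d diagram \<Rightarrow> 'd set set" where
  "crossing_components D = classes_of (darts D) (\<lambda>d e. e = opp D d \<or> e = rot D d)"

text \<open>The last clause is Euler's formula, i.e. every component is drawn on a sphere.\<close>

definition link_diagram :: "'d diagram \<Rightarrow> bool" where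
  "link_diagram D \<longleftrightarrow>
     finite (darts D) \<and> finite (circles D) \<and> darts D \<inter> circles D = {} \<and>
     opp D permutes darts D \<and> (\<forall>d\<in>darts D. opp D d \<noteq> d \<and> opp D (opp D d) = d) \<and>
     rot D permutes darts D \<and> (\<forall>d\<in>darts D. card (orbit (rot D) d) = 4) \<and>
     (\<forall>d\<in>darts D. over D (rot D d) \<longleftrightarrow> \<not> over D d) \<and>
     (\<forall>C\<in>crossing_components D.
        int (card (orbit (rot D) ` C)) - int (card (orbit (opp D) ` C))
          + int (card (orbit (face_step D) ` C)) = 2)"

definition num_components :: "'d diagram \<Rightarrow> nat" where
  "num_components D = card (crossing_components D) + card (circles D)"

definition num_crossings :: "'d diagram \<Rightarrow> nat" where
  "num_crossings D = card (orbit (rot D) ` darts D)"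

text \<open>Turning an over-strand counterclockwise sweeps the corners between an over-dart d and
  rot d. The A-smoothing merges these two corners, so it connects each under-dart d
  with rot d; the B-smoothing connects each over-dart d with
  rot d.\<close>

definition A_state :: "'d diagram \<Rightarrow> 'd set set" where
  "A_state D = classes_of (darts D) (\<lambda>d e. e = opp D d \<or> (\<not> over D d \<and> e = rot D d))"

definition B_state :: "'d diagram \<Rightarrow> 'd set set" where
  "B_state D = classes_of (darts D) (\<lambda>d e. e = opp D d \<or> (over D d \<and> e = rot D d))"

definition s_A :: "'d diagram \<Rightarrow> nat" where
  "s_A D = card (A_state D) + card (circles D)"

definition s_B :: "'d diagram \<Rightarrow> nat" where
  "s_B D = card (B_state D) + card (circles D)"

definition turaev_genus :: "'d diagram \<Rightarrow> real" where
  "turaev_genus D =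
     (2 * real (num_components D) + real (num_crossings D) - real (s_A D) - real (s_B D)) / 2"


section \<open>Alternating decomposition graphs\<close>

definition nonalternating :: "'d diagram \<Rightarrow> 'd \<Rightarrow> bool" where
  "nonalternating D d \<longleftrightarrow> (over D d \<longleftrightarrow> over D (opp D d))"

text \<open>The marked points are the darts of non-alternating edges, each marked point lying close to the
  crossing of its dart. From the marked point d, moving away from the other marked point of its edge,
  the boundary walk of a face continues with the darts
  rot d, face\_step (rot d), and so on; the next marked point met is the first
  non-alternating dart of this sequence. The relation gives the arc on one side
  of d; the arc on the other side is obtained with the roles of the two darts exchanged.\<close>

definition marked_points :: "'d diagram \<Rightarrow> 'd set" where
  "marked_points D = {d \<in> darts D. nonalternating D d}"

definition arc :: "'d diagram \<Rightarrow> 'd \<Rightarrow> 'd \<Rightarrow> bool" where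
  "arc D d e \<longleftrightarrow> d \<in> marked_points D \<and> e \<in> marked_points D \<and>
     (\<exists>n. e = (face_step D ^^ n) (rot D d) \<and>
          (\<forall>i<n. \<not> nonalternating D ((face_step D ^^ i) (rot D d))))"

text \<open>A curve is represented by the set of marked points on it.\<close>

definition curves :: "'d diagram \<Rightarrow> 'd set set" where
  "curves D = classes_of (marked_points D) (arc D)"

text \<open>Besides the curves, there is one vertex for each connected component that is alternating.\<close>

definition alternating_decomposition_graph :: "'d diagram \<Rightarrow> ('d set, 'd set) mgraph" where
  "alternating_decomposition_graph D =
     \<lparr>verts = curves D \<union> {C \<in> crossing_components D. \<forall>d\<in>C. \<not> nonalternating D d}
                \<union> (\<lambda>x. {x}) ` circles D,
      edges = {{d, opp D d} |d. d \<in> darts D \<and> nonalternating D d},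
      ends = (\<lambda>e. {\<gamma> \<in> curves D. \<gamma> \<inter> e \<noteq> {}})\<rparr>"

text \<open>Being finite, every diagram can be encoded with natural numbers as darts.\<close>

definition has_decomposition_graph :: "nat diagram \<Rightarrow> ('v, 'e) mgraph \<Rightarrow> bool" where
  "has_decomposition_graph D G \<longleftrightarrow>
     link_diagram D \<and> isomorphic (alternating_decomposition_graph D) G"

definition is_alternating_decomposition_graph :: "('v, 'e) mgraph \<Rightarrow> bool" where
  "is_alternating_decomposition_graph G \<longleftrightarrow> (\<exists>D. has_decomposition_graph D G)"

text \<open>The diagram is an arbitrary choice; the value does not depend on it.\<close>

definition graph_turaev_genus :: "('v, 'e) mgraph \<Rightarrow> real" where
  "graph_turaev_genus G = turaev_genus (SOME D. has_decomposition_graph D G)"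

end

theory Submission
  imports Defs "HOL-Library.Z2" "HOL-Library.Function_Algebras" "HOL-Library.Product_Plus"
    "HOL-Library.Disjoint_Sets"
begin

text \<open>Let C be the cut space over the field with two elements of the decomposition graph of a
  diagram D with Turaev genus g, and B the space of bicycles, i.e. of cuts orthogonal to all cuts.
  Then 4 to the power g equals the number of all edge sets divided by |C||B|. Indeed, since D is
  drawn on a sphere, C consists of the cocycles of D supported on the non-alternating edges, and a
  function that is constant along the state circles is a sum p + q of a function p on the crossings
  and a function q on the faces. Such a sum is constant along the state circles if and only if p and q
  have the same coboundary on every non-alternating edge and p agrees at the two ends of every
  alternating edge, and the common coboundaries are exactly the bicycles. Counting the pairs (p, q)
  and using Euler's formula gives the equation.

  The quotient makes sense for every multigraph, and a doubled path contraction preserves it: the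
  contracted graph has two edges less, its cuts are those cuts of the original graph that avoid
  the contracted edges, and the star of an interior vertex of the doubled path is a bicycle that
  contains them, so both |C| and |B| are halved.\<close>

section \<open>Linear algebra over the field with two elements\<close>

text \<open>The graphs in the middle of an equivalence need not be bipartite, so they may come from
  no diagram and carry no genus. This forces an invariant read off the graph alone; being equal to a
  function of the genus, it also settles the choice of diagram hidden in
  \<open>graph_turaev_genus\<close>. The powers of two arise because crossings, faces, components
  and state circles are counted by the spaces of bit functions constant on them; dimensions are
  handled throughout as cardinalities. Planarity enters twice, each time through one statement on
  permutations \<open>a\<close>, \<open>b\<close> and \<open>a \<circ> b\<close> that form a genus 0
  hypermap: whatever is orthogonal to all functions invariant under \<open>a\<close> and to all
  those invariant under \<open>b\<close> is a coboundary. One inclusion is formal, and Euler's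
  formula makes the cardinalities agree. The triple \<open>opp\<close>, \<open>corner_step\<close>,
  \<open>rot\<close> shows that cocycles are coboundaries of functions on crossings; the triple
  \<open>corner_step\<close>, inverse of \<open>rot\<close>, \<open>opp\<close> gives the splitting
  p + q, by duality.\<close>

declare add_bit_eq_xor [simp del] mult_bit_eq_and [simp del]

lemma bit_add_self [simp]: "a + a = (0 :: bit)"
  by (cases a) simp_all

lemma bit_add_eq_0_iff: "a + b = 0 \<longleftrightarrow> a = (b :: bit)"
  by (cases a; cases b) simp_all

lemma bit_fun_diff: "x - y = x + (y :: 'a \<Rightarrow> bit)"
  by (simp add: fun_eq_iff)

lemma bit_fun_add_self [simp]: "x + x = (0 :: 'a \<Rightarrow> bit)"
  by (simp add: fun_eq_iff)

lemma bit_fun_add_cancel [simp]: "x + y + y = (x :: 'a \<Rightarrow> bit)"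
  by (simp add: fun_eq_iff add.assoc)

text \<open>For bit functions these are exactly the subspaces. The general type also covers pairs of
  functions, to which rank-nullity is applied below.\<close>

definition additive_subgroup :: "'a :: ab_group_add set \<Rightarrow> bool" where
  "additive_subgroup U \<longleftrightarrow> 0 \<in> U \<and> (\<forall>x\<in>U. \<forall>y\<in>U. x - y \<in> U)"

lemma additive_subgroup_zero: "additive_subgroup U \<Longrightarrow> 0 \<in> U"
  by (simp add: additive_subgroup_def)

lemma additive_subgroup_diff: "additive_subgroup U \<Longrightarrow> x \<in> U \<Longrightarrow> y \<in> U \<Longrightarrow> x - y \<in> U"
  by (simp add: additive_subgroup_def)

lemma additive_subgroup_add: "additive_subgroup U \<Longrightarrow> x \<in> U \<Longrightarrow> y \<in> U \<Longrightarrow> x + y \<in> U"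
  unfolding additive_subgroup_def by (metis diff_0 diff_minus_eq_add)

lemma additive_subgroup_bit_iff:
  "additive_subgroup (U :: ('a \<Rightarrow> bit) set) \<longleftrightarrow> 0 \<in> U \<and> (\<forall>x\<in>U. \<forall>y\<in>U. x + y \<in> U)"
  by (simp add: additive_subgroup_def bit_fun_diff)

lemma additive_subgroup_Int:
  "additive_subgroup U \<Longrightarrow> additive_subgroup V \<Longrightarrow> additive_subgroup (U \<inter> V)"
  by (auto simp: additive_subgroup_def)

lemma additive_subgroup_Times:
  "additive_subgroup U \<Longrightarrow> additive_subgroup V \<Longrightarrow> additive_subgroup (U \<times> V)"
  by (auto simp: additive_subgroup_def zero_prod_def)

text \<open>Rank-nullity in multiplicative form: each nonempty fibre is a translate of the kernel.
  Additivity is demanded on \<open>U\<close> only, in the form of differences to match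
  \<open>additive_subgroup\<close>.\<close>

lemma card_eq_card_image_times_kernel:
  fixes f :: "'a :: ab_group_add \<Rightarrow> 'b :: ab_group_add"
  assumes "finite U" "additive_subgroup U"
    and diff: "\<And>x y. x \<in> U \<Longrightarrow> y \<in> U \<Longrightarrow> f (x - y) = f x - f y"
  shows "card U = card (f ` U) * card {x \<in> U. f x = 0}"
proof -
  have fib: "card {x \<in> U. f x = b} = card {x \<in> U. f x = 0}" if "b \<in> f ` U" for b
  proof -
    obtain a where a: "a \<in> U" "f a = b" using \<open>b \<in> f ` U\<close> by auto
    have plus: "f (x + y) = f x + f y" if "x \<in> U" "y \<in> U" for x y
    proof -
      have z: "0 - y \<in> U" using assms(2) that unfolding additive_subgroup_def by blast
      have "f 0 = 0" using diff[of y y] that by simp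
      then have "f (0 - y) = - f y"
        using diff[of 0 y] that assms(2) by (simp add: additive_subgroup_def)
      then show ?thesis using diff[OF that(1) z] by simp
    qed
    have "bij_betw (\<lambda>x. x - a) {x \<in> U. f x = b} {x \<in> U. f x = 0}"
      by (rule bij_betw_byWitness[where f' = "\<lambda>x. x + a"])
        (use a assms(2) in \<open>auto simp: diff plus additive_subgroup_diff additive_subgroup_add\<close>)
    then show ?thesis by (rule bij_betw_same_card)
  qed
  have "card U = (\<Sum>b\<in>f ` U. card {x \<in> U. f x = b})"
    using sum.group[of U "f ` U" f "\<lambda>_. 1 :: nat"] assms(1) by simp
  also have "\<dots> = card (f ` U) * card {x \<in> U. f x = 0}"
    using fib by simp
  finally show ?thesis .
qed

lemma card_sum_times_card_Int:
  fixes U V :: "('a \<Rightarrow> bit) set"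
  assumes "finite U" "finite V" "additive_subgroup U" "additive_subgroup V"
  shows "card {u + v |u v. u \<in> U \<and> v \<in> V} * card (U \<inter> V) = card U * card V"
proof -
  let ?f = "\<lambda>p :: ('a \<Rightarrow> bit) \<times> ('a \<Rightarrow> bit). fst p - snd p"
  have "card (U \<times> V) = card (?f ` (U \<times> V)) * card {p \<in> U \<times> V. ?f p = 0}"
    using assms by (intro card_eq_card_image_times_kernel additive_subgroup_Times finite_cartesian_product)
      (auto simp: algebra_simps)
  also have "?f ` (U \<times> V) = {u + v |u v. u \<in> U \<and> v \<in> V}"
    by (force simp: bit_fun_diff image_iff)
  also have "{p \<in> U \<times> V. ?f p = 0} = (\<lambda>x. (x, x)) ` (U \<inter> V)"
    by auto
  also have "card \<dots> = card (U \<inter> V)"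
    by (intro card_image inj_onI) simp
  finally show ?thesis by (simp only: card_cartesian_product)
qed

text \<open>Vanishing outside \<open>S\<close> makes each function on \<open>S\<close> a single
  element of the type, so that cardinalities of subspaces are the right powers of two.\<close>

definition vecs :: "'a set \<Rightarrow> ('a \<Rightarrow> bit) set" where
  "vecs S = {x. \<forall>a. a \<notin> S \<longrightarrow> x a = 0}"

section \<open>The standard bilinear form and orthogonal complements\<close>

definition inner_product :: "'a set \<Rightarrow> ('a \<Rightarrow> bit) \<Rightarrow> ('a \<Rightarrow> bit) \<Rightarrow> bit" where
  "inner_product S x y = (\<Sum>a\<in>S. x a * y a)"

definition perp :: "'a set \<Rightarrow> ('a \<Rightarrow> bit) set \<Rightarrow> ('a \<Rightarrow> bit) set" where
  "perp S U = {x \<in> vecs S. \<forall>u\<in>U. inner_product S u x = 0}"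

lemma additive_subgroup_vecs: "additive_subgroup (vecs S)"
  by (auto simp: additive_subgroup_bit_iff vecs_def)

lemma bij_betw_vecs: "bij_betw (\<lambda>A a. if a \<in> A then 1 else 0 :: bit) (Pow S) (vecs S)"
  by (rule bij_betw_byWitness[where f' = "\<lambda>x. {a. x a = 1}"])
    (auto simp: vecs_def fun_eq_iff split: if_splits)

lemma finite_vecs [simp]: "finite S \<Longrightarrow> finite (vecs S)"
  using bij_betw_finite[OF bij_betw_vecs[of S]] by simp

lemma card_vecs: "finite S \<Longrightarrow> card (vecs S) = 2 ^ card S"
  using bij_betw_same_card[OF bij_betw_vecs[of S]] by (simp add: card_Pow)

lemma inner_product_commute: "inner_product S x y = inner_product S y x"
  by (simp add: inner_product_def mult.commute)

lemma inner_product_add_left: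
  "inner_product S (x + y) z = inner_product S x z + inner_product S y z"
  by (simp add: inner_product_def distrib_right sum.distrib)

lemma inner_product_add_right:
  "inner_product S x (y + z) = inner_product S x y + inner_product S x z"
  by (simp add: inner_product_def distrib_left sum.distrib)

lemma inner_product_zero [simp]: "inner_product S 0 x = 0" "inner_product S x 0 = 0"
  by (simp_all add: inner_product_def)

lemma inner_product_nondegenerate:
  assumes "finite S" "u \<in> vecs S" "\<forall>x\<in>vecs S. inner_product S u x = 0"
  shows "u = 0"
proof
  fix a
  show "u a = 0 a"
  proof (cases "a \<in> S")
    case True
    then have "(\<lambda>b. if b = a then 1 else 0) \<in> vecs S" by (auto simp: vecs_def)
    then have "inner_product S u (\<lambda>b. if b = a then 1 else 0) = 0" using assms(3) by blast
    then show ?thesis using True assms(1) by (simp add: inner_product_def if_distrib cong: if_cong)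
  next
    case False
    then show ?thesis using assms(2) by (simp add: vecs_def)
  qed
qed

lemma perp_subset: "perp S U \<subseteq> vecs S"
  by (auto simp: perp_def)

lemma additive_subgroup_perp: "additive_subgroup (perp S U)"
  using additive_subgroup_vecs[of S]
  by (auto simp: additive_subgroup_bit_iff perp_def inner_product_add_right)

text \<open>The nontrivial additive character of the field with two elements.\<close>

definition bit_sign :: "bit \<Rightarrow> int" where
  "bit_sign b = (if b = 0 then 1 else - 1)"

text \<open>Orthogonality of characters: translation by an element where \<open>f\<close> is 1
  permutes \<open>U\<close> and reverses every sign, so the sum equals its own negative.\<close>

lemma sum_bit_sign:
  fixes f :: "('a \<Rightarrow> bit) \<Rightarrow> bit"
  assumes "finite U" "additive_subgroup U" and add: "\<And>x y. f (x + y) = f x + f y"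
  shows "(\<Sum>u\<in>U. bit_sign (f u)) = (if \<forall>u\<in>U. f u = 0 then int (card U) else 0)"
proof (cases "\<forall>u\<in>U. f u = 0")
  case True
  then show ?thesis by (simp add: bit_sign_def)
next
  case False
  then obtain u0 where u0: "u0 \<in> U" "f u0 = 1" by auto
  have "(\<Sum>u\<in>U. bit_sign (f u)) = (\<Sum>u\<in>U. bit_sign (f (u + u0)))"
    by (rule sum.reindex_bij_witness[where i = "\<lambda>u. u + u0" and j = "\<lambda>u. u + u0"])
      (use assms(2) u0 in \<open>auto simp: additive_subgroup_add\<close>)
  also have "\<dots> = (\<Sum>u\<in>U. - bit_sign (f u))"
  proof (rule sum.cong[OF refl])
    fix u
    show "bit_sign (f (u + u0)) = - bit_sign (f u)"
      using u0 by (cases "f u") (simp_all add: add bit_sign_def)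
  qed
  also have "\<dots> = - (\<Sum>u\<in>U. bit_sign (f u))"
    by (rule sum_negf)
  finally show ?thesis using u0 by force
qed

text \<open>The character sum over all pairs (u, x) is evaluated in both orders. Summing over x
  first leaves only u = 0, by nondegeneracy; summing over u first leaves only the x in
  \<open>perp S U\<close>.\<close>

lemma card_times_card_perp:
  assumes "finite S" "additive_subgroup U" "U \<subseteq> vecs S"
  shows "card U * card (perp S U) = 2 ^ card S"
proof -
  have fin: "finite U" using assms finite_subset finite_vecs by blast
  have "(\<Sum>u\<in>U. \<Sum>x\<in>vecs S. bit_sign (inner_product S u x))
      = (\<Sum>u\<in>U. if u = 0 then int (2 ^ card S) else 0)"
  proof (rule sum.cong[OF refl])
    fix u assume "u \<in> U"
    then have "(\<forall>x\<in>vecs S. inner_product S u x = 0) \<longleftrightarrow> u = 0"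
      using inner_product_nondegenerate[OF assms(1)] assms(3) by auto
    then show "(\<Sum>x\<in>vecs S. bit_sign (inner_product S u x))
        = (if u = 0 then int (2 ^ card S) else 0)"
      by (subst sum_bit_sign)
        (use assms(1) in \<open>auto simp: additive_subgroup_vecs inner_product_add_right card_vecs\<close>)
  qed
  also have "\<dots> = int (2 ^ card S)"
    using fin assms(2) by (simp add: additive_subgroup_def)
  finally have 1: "(\<Sum>u\<in>U. \<Sum>x\<in>vecs S. bit_sign (inner_product S u x)) = int (2 ^ card S)" .
  have "(\<Sum>x\<in>vecs S. \<Sum>u\<in>U. bit_sign (inner_product S u x))
      = (\<Sum>x\<in>vecs S. if x \<in> perp S U then int (card U) else 0)"
  proof (rule sum.cong[OF refl])
    fix x assume "x \<in> vecs S"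
    then show "(\<Sum>u\<in>U. bit_sign (inner_product S u x))
        = (if x \<in> perp S U then int (card U) else 0)"
      by (subst sum_bit_sign) (use fin assms(2) in \<open>auto simp: inner_product_add_left perp_def\<close>)
  qed
  also have "\<dots> = int (card U * card (perp S U))"
    using assms(1) perp_subset[of S U]
    by (simp add: sum.If_cases Int_absorb1 Int_commute mult.commute)
  finally have 2: "(\<Sum>x\<in>vecs S. \<Sum>u\<in>U. bit_sign (inner_product S u x))
      = int (card U * card (perp S U))" .
  have "int (card U * card (perp S U)) = int (2 ^ card S)"
    using 1 2 sum.swap[of "\<lambda>u x. bit_sign (inner_product S u x)" "vecs S" U] by simp
  then show ?thesis by (simp only: of_nat_eq_iff)
qed

text \<open>\<open>U\<close> lies in its double complement, and two applications of the product
  formula give both the same cardinality.\<close>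

lemma perp_perp:
  assumes "finite S" "additive_subgroup U" "U \<subseteq> vecs S"
  shows "perp S (perp S U) = U"
proof -
  have sub: "U \<subseteq> perp S (perp S U)"
    using assms(3) by (auto simp: perp_def inner_product_commute)
  have "card U * card (perp S U) = card (perp S (perp S U)) * card (perp S U)"
    using card_times_card_perp[OF assms]
      card_times_card_perp[OF assms(1) additive_subgroup_perp perp_subset, of U]
    by (simp add: mult.commute)
  moreover have "card (perp S U) > 0"
    using assms(1) perp_subset[of S U] additive_subgroup_zero[OF additive_subgroup_perp[of S U]]
    by (metis card_gt_0_iff empty_iff finite_subset finite_vecs)
  ultimately have "card U = card (perp S (perp S U))" by simp
  then show ?thesis
    using sub assms(1) perp_subset by (metis card_subset_eq finite_subset finite_vecs)
qed

lemma additive_subgroup_sum: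
  fixes U V :: "('a \<Rightarrow> bit) set"
  assumes "additive_subgroup U" "additive_subgroup V"
  shows "additive_subgroup {u + v |u v. u \<in> U \<and> v \<in> V}"
proof -
  have "0 + 0 \<in> {u + v |u v. u \<in> U \<and> v \<in> V}"
    using assms additive_subgroup_zero by blast
  moreover have "x + y \<in> {u + v |u v. u \<in> U \<and> v \<in> V}"
    if xy: "x \<in> {u + v |u v. u \<in> U \<and> v \<in> V}" "y \<in> {u + v |u v. u \<in> U \<and> v \<in> V}" for x y
  proof -
    obtain a b c d where "x = a + b" "y = c + d" "a \<in> U" "b \<in> V" "c \<in> U" "d \<in> V"
      using xy by blast
    then have "x + y = (a + c) + (b + d)" "a + c \<in> U" "b + d \<in> V"
      using assms by (auto simp: additive_subgroup_add algebra_simps)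
    then show ?thesis by blast
  qed
  ultimately show ?thesis by (simp add: additive_subgroup_bit_iff)
qed

lemma perp_sum:
  assumes "additive_subgroup U" "additive_subgroup V"
  shows "perp S {u + v |u v. u \<in> U \<and> v \<in> V} = perp S U \<inter> perp S V"
proof (intro equalityI subsetI)
  fix x assume x: "x \<in> perp S {u + v |u v. u \<in> U \<and> v \<in> V}"
  have "inner_product S (u + 0) x = 0" if "u \<in> U" for u
    using x that additive_subgroup_zero[OF assms(2)] unfolding perp_def by blast
  moreover have "inner_product S (0 + v) x = 0" if "v \<in> V" for v
    using x that additive_subgroup_zero[OF assms(1)] unfolding perp_def by blast
  ultimately show "x \<in> perp S U \<inter> perp S V" using x by (simp add: perp_def)
next
  fix x assume "x \<in> perp S U \<inter> perp S V"
  then show "x \<in> perp S {u + v |u v. u \<in> U \<and> v \<in> V}"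
    by (auto simp: perp_def inner_product_add_left)
qed

section \<open>Vectors invariant under a relation or a permutation\<close>

text \<open>Such a vector is a function on the blocks: \<open>f\<close> spreads the value of a block
  over its elements, \<open>g\<close> reads it off at a chosen representative. Through this lemma
  numbers of orbits and classes become exponents.\<close>

lemma card_constant_on_blocks:
  assumes "finite S" "partition_on S P"
  shows "card {x \<in> vecs S. \<forall>B\<in>P. \<forall>a\<in>B. \<forall>b\<in>B. x a = x b} = 2 ^ card P"
proof -
  have un: "\<Union>P = S" and ne: "{} \<notin> P" using assms(2) by (auto simp: partition_on_def)
  have dj: "B = B'" if "B \<in> P" "B' \<in> P" "a \<in> B" "a \<in> B'" for B B' a
    using disjointD[OF partition_onD2[OF assms(2)], of B B'] that by blast
  define block where "block a = (THE B. B \<in> P \<and> a \<in> B)" for a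
  have block: "block a = B" if "B \<in> P" "a \<in> B" for a B
    unfolding block_def by (rule the_equality) (use that dj in \<open>blast+\<close>)
  define f where "f y = (\<lambda>a. if a \<in> S then y (block a) else 0)" for y :: "'a set \<Rightarrow> bit"
  define g where "g x = (\<lambda>B. if B \<in> P then x (SOME a. a \<in> B) else 0)" for x :: "'a \<Rightarrow> bit"
  have some: "(SOME a. a \<in> B) \<in> B" if "B \<in> P" for B
    using that ne by (metis some_in_eq)
  have "bij_betw f (vecs P) {x \<in> vecs S. \<forall>B\<in>P. \<forall>a\<in>B. \<forall>b\<in>B. x a = x b}"
  proof (rule bij_betw_byWitness[where f' = g])
    show "\<forall>y\<in>vecs P. g (f y) = y"
    proof (intro ballI ext)
      fix y B assume y: "y \<in> vecs P"
      show "g (f y) B = y B"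
      proof (cases "B \<in> P")
        case True
        then have "(SOME a. a \<in> B) \<in> S" "block (SOME a. a \<in> B) = B"
          using some[OF True] un block by auto
        then show ?thesis using True by (simp add: f_def g_def)
      qed (use y in \<open>auto simp: g_def vecs_def\<close>)
    qed
    show "\<forall>x\<in>{x \<in> vecs S. \<forall>B\<in>P. \<forall>a\<in>B. \<forall>b\<in>B. x a = x b}. f (g x) = x"
    proof (intro ballI ext)
      fix x a assume x: "x \<in> {x \<in> vecs S. \<forall>B\<in>P. \<forall>a\<in>B. \<forall>b\<in>B. x a = x b}"
      show "f (g x) a = x a"
      proof (cases "a \<in> S")
        case True
        obtain B where "B \<in> P" "a \<in> B" using True un by blast
        moreover have "x (SOME a. a \<in> B) = x a"
          using x some \<open>B \<in> P\<close> \<open>a \<in> B\<close> by blast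
        ultimately show ?thesis using True block by (simp add: f_def g_def)
      qed (use x in \<open>auto simp: f_def vecs_def\<close>)
    qed
    show "f ` vecs P \<subseteq> {x \<in> vecs S. \<forall>B\<in>P. \<forall>a\<in>B. \<forall>b\<in>B. x a = x b}"
    proof (intro image_subsetI CollectI conjI ballI)
      fix y B a b assume "B \<in> P" "a \<in> B" "b \<in> B"
      then show "f y a = f y b" using block[of B] un by (auto simp: f_def)
    qed (auto simp: f_def vecs_def)
    show "g ` {x \<in> vecs S. \<forall>B\<in>P. \<forall>a\<in>B. \<forall>b\<in>B. x a = x b} \<subseteq> vecs P"
      by (auto simp: g_def vecs_def)
  qed
  then show ?thesis
    using bij_betw_same_card card_vecs[OF finite_elements[OF assms]] by (metis (no_types, lifting))
qed

definition respecting :: "'a set \<Rightarrow> ('a \<Rightarrow> 'a \<Rightarrow> bool) \<Rightarrow> ('a \<Rightarrow> bit) set" where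
  "respecting S r = {x \<in> vecs S. \<forall>a\<in>S. \<forall>b\<in>S. r a b \<longrightarrow> x a = x b}"

definition invariant_vecs :: "'a set \<Rightarrow> ('a \<Rightarrow> 'a) \<Rightarrow> ('a \<Rightarrow> bit) set" where
  "invariant_vecs S f = {x \<in> vecs S. \<forall>a\<in>S. x (f a) = x a}"

lemma constant_on_class:
  assumes "equivclp (\<lambda>a b. a \<in> S \<and> b \<in> S \<and> r a b) a b"
    and "\<And>a b. a \<in> S \<Longrightarrow> b \<in> S \<Longrightarrow> r a b \<Longrightarrow> x a = x b"
  shows "x a = x b"
  using assms(1)
proof (induction rule: equivclp_induct)
  case base
  then show ?case by simp
next
  case (step y z)
  then show ?case using assms(2)[of y z] assms(2)[of z y] by auto
qed

lemma partition_on_classes_of: "partition_on S (classes_of S r)"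
proof (rule partition_onI)
  let ?R = "equivclp (\<lambda>a b. a \<in> S \<and> b \<in> S \<and> r a b)"
  show "\<Union>(classes_of S r) = S"
    unfolding classes_of_def using equivclp_refl[of "\<lambda>a b. a \<in> S \<and> b \<in> S \<and> r a b"] by blast
  show "{} \<notin> classes_of S r"
    unfolding classes_of_def using equivclp_refl[of "\<lambda>a b. a \<in> S \<and> b \<in> S \<and> r a b"] by blast
  show "disjnt p q" if pq: "p \<in> classes_of S r" "q \<in> classes_of S r" "p \<noteq> q" for p q
  proof (rule ccontr)
    assume "\<not> disjnt p q"
    then obtain a where a: "a \<in> p" "a \<in> q" by (auto simp: disjnt_def)
    obtain u v where uv: "p = {y \<in> S. ?R u y}" "q = {y \<in> S. ?R v y}"
      using pq unfolding classes_of_def by auto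
    have "?R u v" "?R v u"
      using a uv by (auto intro: equivclp_trans equivclp_sym)
    then have "p = q" using uv by (auto intro: equivclp_trans)
    then show False using pq by simp
  qed
qed

lemma classes_of_closed:
  assumes "B \<in> classes_of S r" "a \<in> B" "b \<in> S" "r a b"
  shows "b \<in> B"
proof -
  let ?R = "equivclp (\<lambda>a b. a \<in> S \<and> b \<in> S \<and> r a b)"
  obtain u where u: "B = {y \<in> S. ?R u y}" using assms(1) unfolding classes_of_def by auto
  have "?R u a" "a \<in> S" using assms(2) u by auto
  moreover have "?R a b" using assms \<open>a \<in> S\<close> by (auto intro: r_into_equivclp)
  ultimately show ?thesis using u assms(3) by (auto intro: equivclp_trans)
qed

lemma respecting_classes:
  "respecting S r = {x \<in> vecs S. \<forall>B\<in>classes_of S r. \<forall>a\<in>B. \<forall>b\<in>B. x a = x b}"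
proof (intro equalityI subsetI)
  fix x assume x: "x \<in> respecting S r"
  have "x a = x b" if "B \<in> classes_of S r" "a \<in> B" "b \<in> B" for B a b
  proof -
    obtain u where "B = {y \<in> S. equivclp (\<lambda>a b. a \<in> S \<and> b \<in> S \<and> r a b) u y}"
      using \<open>B \<in> classes_of S r\<close> unfolding classes_of_def by auto
    then have "x u = x c" if "c \<in> B" for c
      using that constant_on_class[of S r u c x] x by (simp add: respecting_def)
    then show ?thesis using that by metis
  qed
  then show "x \<in> {x \<in> vecs S. \<forall>B\<in>classes_of S r. \<forall>a\<in>B. \<forall>b\<in>B. x a = x b}"
    using x unfolding respecting_def by blast
next
  fix x assume x: "x \<in> {x \<in> vecs S. \<forall>B\<in>classes_of S r. \<forall>a\<in>B. \<forall>b\<in>B. x a = x b}"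
  have "x a = x b" if "a \<in> S" "b \<in> S" "r a b" for a b
  proof -
    obtain B where "B \<in> classes_of S r" "a \<in> B"
      using \<open>a \<in> S\<close> partition_onD1[OF partition_on_classes_of[of S r]] by blast
    then show ?thesis using x that classes_of_closed[of B S r a b] by blast
  qed
  then show "x \<in> respecting S r" using x unfolding respecting_def by blast
qed

lemma card_respecting: "finite S \<Longrightarrow> card (respecting S r) = 2 ^ card (classes_of S r)"
  unfolding respecting_classes by (intro card_constant_on_blocks partition_on_classes_of)

section \<open>Permutations, their orbits and their invariant functions\<close>

lemma permutes_self_in_orbit: "f permutes S \<Longrightarrow> finite S \<Longrightarrow> a \<in> orbit f a"
  by (intro permutation_self_in_orbit) (auto simp: permutation_permutes)

lemma permutes_orbit_eq: "f permutes S \<Longrightarrow> finite S \<Longrightarrow> b \<in> orbit f a \<Longrightarrow> orbit f b = orbit f a"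
  by (rule orbit_cyclic_eq3[OF cyclic_on_orbit])

lemma partition_on_orbits:
  assumes "f permutes S" "finite S"
  shows "partition_on S (orbit f ` S)"
proof (rule partition_onI)
  show "\<Union>(orbit f ` S) = S"
    using permutes_orbit_subset[OF assms(1)] permutes_self_in_orbit[OF assms] by blast
  show "{} \<notin> orbit f ` S"
    using orbit_nonempty[of f] by auto
  show "disjnt p q" if "p \<in> orbit f ` S" "q \<in> orbit f ` S" "p \<noteq> q" for p q
    using that permutes_orbit_eq[OF assms] unfolding disjnt_iff by (metis imageE)
qed

lemma card_invariant_vecs:
  assumes "f permutes S" "finite S"
  shows "card (invariant_vecs S f) = 2 ^ card (orbit f ` S)"
proof -
  have "invariant_vecs S f = {x \<in> vecs S. \<forall>B\<in>orbit f ` S. \<forall>a\<in>B. \<forall>b\<in>B. x a = x b}"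
  proof (intro equalityI subsetI)
    fix x assume x: "x \<in> invariant_vecs S f"
    have "x b = x a" if "a \<in> S" "b \<in> orbit f a" for a b
      using that(2)
    proof induction
      case base
      then show ?case using x that by (simp add: invariant_vecs_def)
    next
      case (step y)
      then show ?case
        using x that permutes_orbit_subset[OF assms(1) that(1)] by (auto simp: invariant_vecs_def)
    qed
    then have "\<forall>B\<in>orbit f ` S. \<forall>a\<in>B. \<forall>b\<in>B. x a = x b"
      by (metis imageE)
    then show "x \<in> {x \<in> vecs S. \<forall>B\<in>orbit f ` S. \<forall>a\<in>B. \<forall>b\<in>B. x a = x b}"
      using x unfolding invariant_vecs_def by blast
  next
    fix x assume "x \<in> {x \<in> vecs S. \<forall>B\<in>orbit f ` S. \<forall>a\<in>B. \<forall>b\<in>B. x a = x b}"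
    then show "x \<in> invariant_vecs S f"
      using permutes_self_in_orbit[OF assms] orbit.base[of f] unfolding invariant_vecs_def by blast
  qed
  then show ?thesis
    using card_constant_on_blocks[OF assms(2) partition_on_orbits[OF assms]] by simp
qed

lemma invariant_vecs_apply:
  assumes "f permutes S" "x \<in> invariant_vecs S f"
  shows "x (f a) = x a"
  using assms by (cases "a \<in> S") (auto simp: invariant_vecs_def permutes_def)

lemma invariant_vecs_subset: "invariant_vecs S f \<subseteq> vecs S"
  by (auto simp: invariant_vecs_def)

lemma additive_subgroup_invariant_vecs: "additive_subgroup (invariant_vecs S f)"
  using additive_subgroup_vecs[of S] by (auto simp: additive_subgroup_bit_iff invariant_vecs_def)

lemma vecs_comp_permutes: "f permutes S \<Longrightarrow> x \<in> vecs S \<Longrightarrow> x \<circ> f \<in> vecs S"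
  by (auto simp: vecs_def permutes_not_in)

lemma inner_product_comp_permutes:
  "f permutes S \<Longrightarrow> inner_product S (x \<circ> f) (y \<circ> f) = inner_product S x y"
  unfolding inner_product_def using sum.permute[of f S "\<lambda>a. x a * y a"] by (simp add: comp_def)

text \<open>The Euler characteristic hypothesis says that every component of the hypermap with vertices,
  hyperedges and faces the orbits of a, b and their composition has genus 0, so this is the vanishing
  of first cohomology.\<close>

lemma perp_invariant_vecs_Int:
  assumes S: "finite S" and ab: "a permutes S" "b permutes S"
    and k: "card (invariant_vecs S a \<inter> invariant_vecs S b) = 2 ^ k"
    and euler: "card (orbit a ` S) + card (orbit b ` S) + card (orbit (a \<circ> b) ` S) = card S + 2 * k"
  shows "perp S (invariant_vecs S a) \<inter> perp S (invariant_vecs S b)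
    = {y + (y \<circ> a) |y. y \<in> invariant_vecs S (a \<circ> b)}"
proof -
  let ?Ia = "invariant_vecs S a" and ?Ib = "invariant_vecs S b" and ?Ic = "invariant_vecs S (a \<circ> b)"
  let ?P = "perp S ?Ia \<inter> perp S ?Ib" and ?Q = "(\<lambda>y. y + (y \<circ> a)) ` ?Ic"
  note sub = additive_subgroup_invariant_vecs
  have c: "a \<circ> b permutes S" using ab by (simp add: permutes_compose)
  have fin: "finite ?Ia" "finite ?Ib" "finite ?Ic"
    using finite_subset[OF invariant_vecs_subset finite_vecs[OF S]] by auto
  \<comment> \<open>Permuting both arguments preserves the inner product. Hence y and
    \<open>y \<circ> a\<close> pair equally with a function invariant under \<open>a\<close>, and,
    since \<open>(y \<circ> a) \<circ> b = y\<close>, also with one invariant under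
    \<open>b\<close>; the two contributions cancel.\<close>
  have "?Q \<subseteq> ?P"
  proof (rule image_subsetI)
    fix y assume y: "y \<in> ?Ic"
    have v: "y + (y \<circ> a) \<in> vecs S"
      using subsetD[OF invariant_vecs_subset y] vecs_comp_permutes[OF ab(1), of y]
      by (intro additive_subgroup_add[OF additive_subgroup_vecs]) blast+
    have "inner_product S z (y \<circ> a) = inner_product S z y" if "z \<in> ?Ia" for z
    proof -
      have "z \<circ> a = z" using invariant_vecs_apply[OF ab(1) that] by auto
      then show ?thesis using inner_product_comp_permutes[OF ab(1), of z y] by metis
    qed
    moreover have "inner_product S z (y \<circ> a) = inner_product S z y" if "z \<in> ?Ib" for z
    proof -
      have "z \<circ> b = z" using invariant_vecs_apply[OF ab(2) that] by auto
      moreover have "(y \<circ> a) \<circ> b = y" using invariant_vecs_apply[OF c y] by auto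
      ultimately show ?thesis using inner_product_comp_permutes[OF ab(2), of z "y \<circ> a"] by metis
    qed
    ultimately show "y + (y \<circ> a) \<in> ?P" using v by (simp add: perp_def inner_product_add_right)
  qed
  \<comment> \<open>Let A, B, C be the numbers of orbits of \<open>a\<close>, \<open>b\<close> and
    \<open>a \<circ> b\<close>. The kernel of the coboundary map consists of the functions invariant
    under both permutations, so \<open>?Q\<close> has exponent C - k. The sum \<open>?U\<close> has
    exponent A + B - k, so its complement \<open>?P\<close> has exponent |S| - A - B + k. The
    hypothesis \<open>euler\<close> says that these agree.\<close>
  moreover have "card ?Q = card ?P"
  proof -
    have "{y \<in> ?Ic. y + (y \<circ> a) = 0} = ?Ia \<inter> ?Ib"
    proof (intro equalityI subsetI)
      fix y assume "y \<in> {y \<in> ?Ic. y + (y \<circ> a) = 0}"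
      then have y: "y \<in> ?Ic" "y (a d) = y d" for d by (auto simp: fun_eq_iff bit_add_eq_0_iff)
      have "y (b d) = y d" for d using invariant_vecs_apply[OF c y(1), of d] y(2)[of "b d"] by simp
      then show "y \<in> ?Ia \<inter> ?Ib" using y by (auto simp: invariant_vecs_def)
    next
      fix y assume "y \<in> ?Ia \<inter> ?Ib"
      then have y: "y (a d) = y d" "y (b d) = y d" "y \<in> vecs S" for d
        using invariant_vecs_apply[OF ab(1), of y] invariant_vecs_apply[OF ab(2), of y]
        by (auto simp: invariant_vecs_def)
      then show "y \<in> {y \<in> ?Ic. y + (y \<circ> a) = 0}" by (auto simp: invariant_vecs_def fun_eq_iff)
    qed
    moreover have "(y - z) + ((y - z) \<circ> a) = (y + (y \<circ> a)) - (z + (z \<circ> a))" for y z :: "'a \<Rightarrow> bit"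
      by (auto simp: fun_eq_iff ac_simps)
    ultimately have "card ?Ic = card ?Q * 2 ^ k"
      using card_eq_card_image_times_kernel[OF fin(3) sub, of "\<lambda>y. y + (y \<circ> a)"] k by metis
    then have Q: "card ?Q * 2 ^ k = 2 ^ card (orbit (a \<circ> b) ` S)"
      using card_invariant_vecs[OF c S] by simp
    let ?U = "{u + v |u v. u \<in> ?Ia \<and> v \<in> ?Ib}"
    have U: "card ?U * 2 ^ k = 2 ^ card (orbit a ` S) * 2 ^ card (orbit b ` S)"
      using card_sum_times_card_Int[OF fin(1,2) sub sub] k
        card_invariant_vecs[OF ab(1) S] card_invariant_vecs[OF ab(2) S] by simp
    have "?U \<subseteq> vecs S"
      using invariant_vecs_subset[of S] additive_subgroup_add[OF additive_subgroup_vecs[of S]] by blast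
    then have P: "card ?U * card ?P = 2 ^ card S"
      using card_times_card_perp[OF S additive_subgroup_sum[OF sub sub], of S a S b]
        perp_sum[OF sub sub, of S S a S b] by simp
    have "(2 ^ k * card ?U) * (card ?Q * 2 ^ k) = 2 ^ (card S + 2 * k)"
      unfolding Q mult.commute[of "2 ^ k" "card ?U"] U by (simp only: flip: euler power_add)
    also have "\<dots> = 2 ^ k * (card ?U * card ?P) * 2 ^ k"
      unfolding P by (simp add: power_add mult_2)
    also have "\<dots> = (2 ^ k * card ?U) * (card ?P * 2 ^ k)"
      by (simp only: mult.assoc)
    finally show "card ?Q = card ?P" using U by (cases "card ?U = 0") simp_all
  qed
  moreover have "finite ?P" using finite_subset[OF perp_subset finite_vecs[OF S]] by auto
  ultimately have "?Q = ?P" by (metis card_subset_eq)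
  then show ?thesis by blast
qed

section \<open>The cut space of a multigraph\<close>

text \<open>Loops get the value 0 because u = v is allowed.\<close>

definition cut_space :: "('v, 'e) mgraph \<Rightarrow> ('e \<Rightarrow> bit) set" where
  "cut_space G = {x \<in> vecs (edges G).
     \<exists>p. \<forall>e\<in>edges G. \<forall>u v. ends G e = {u, v} \<longrightarrow> x e = p u + p v}"

definition bicycle_space :: "('v, 'e) mgraph \<Rightarrow> ('e \<Rightarrow> bit) set" where
  "bicycle_space G = cut_space G \<inter> perp (edges G) (cut_space G)"

definition bicycle_weight :: "('v, 'e) mgraph \<Rightarrow> real" where
  "bicycle_weight G =
     2 ^ card (edges G) / (real (card (cut_space G)) * real (card (bicycle_space G)))"

lemma additive_subgroup_cut_space: "additive_subgroup (cut_space G)"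
proof -
  have "0 \<in> cut_space G"
    unfolding cut_space_def using additive_subgroup_zero[OF additive_subgroup_vecs]
    by (auto intro!: exI[of _ "\<lambda>_. 0"])
  moreover have "x + y \<in> cut_space G" if xy: "x \<in> cut_space G" "y \<in> cut_space G" for x y
  proof -
    obtain p q where p: "\<forall>e\<in>edges G. \<forall>u v. ends G e = {u, v} \<longrightarrow> x e = p u + p v"
      and q: "\<forall>e\<in>edges G. \<forall>u v. ends G e = {u, v} \<longrightarrow> y e = q u + q v"
      using xy unfolding cut_space_def by auto
    have "(x + y) e = (p u + q u) + (p v + q v)" if "e \<in> edges G" "ends G e = {u, v}" for e u v
      using p q that by (simp add: algebra_simps)
    moreover have "x + y \<in> vecs (edges G)"
      using xy additive_subgroup_add[OF additive_subgroup_vecs] by (auto simp: cut_space_def)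
    ultimately show ?thesis
      unfolding cut_space_def by (intro CollectI conjI exI[of _ "\<lambda>u. p u + q u"]) auto
  qed
  ultimately show ?thesis by (simp add: additive_subgroup_bit_iff)
qed

lemma cut_space_subset: "cut_space G \<subseteq> vecs (edges G)"
  by (auto simp: cut_space_def)

lemma finite_cut_space: "finite (edges G) \<Longrightarrow> finite (cut_space G)"
  using cut_space_subset finite_vecs finite_subset by metis

lemma additive_subgroup_bicycle_space: "additive_subgroup (bicycle_space G)"
  unfolding bicycle_space_def
  by (intro additive_subgroup_Int additive_subgroup_cut_space additive_subgroup_perp)

lemma multigraph_ends:
  assumes "multigraph G" "e \<in> edges G"
  obtains u v where "ends G e = {u, v}" "u \<in> verts G" "v \<in> verts G"
proof -
  have "ends G e \<subseteq> verts G" "card (ends G e) = 1 \<or> card (ends G e) = 2"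
    using assms by (auto simp: multigraph_def)
  then show thesis using that by (auto simp: card_1_singleton_iff card_2_iff)
qed

lemma multigraph_isomorphic:
  assumes "multigraph G" "isomorphic G H"
  shows "multigraph H"
proof -
  obtain f g where f: "bij_betw f (verts G) (verts H)" and g: "bij_betw g (edges G) (edges H)"
    and fg: "\<forall>e\<in>edges G. ends H (g e) = f ` ends G e"
    using assms(2) unfolding isomorphic_def by auto
  have "ends H e' \<subseteq> verts H \<and> card (ends H e') \<in> {1, 2}" if "e' \<in> edges H" for e'
  proof -
    obtain e where e: "e \<in> edges G" "e' = g e" using g \<open>e' \<in> edges H\<close> by (auto simp: bij_betw_def)
    have sub: "ends G e \<subseteq> verts G" "card (ends G e) \<in> {1, 2}"
      using assms(1) e by (auto simp: multigraph_def)
    have "card (f ` ends G e) = card (ends G e)" "f ` ends G e \<subseteq> verts H"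
      using f sub(1) by (auto simp: bij_betw_def intro!: card_image intro: inj_on_subset)
    then show ?thesis using e fg sub by simp
  qed
  then show ?thesis
    using assms(1) bij_betw_finite[OF f] bij_betw_finite[OF g] by (simp add: multigraph_def)
qed

lemma bicycle_weight_isomorphic:
  assumes "multigraph G" "isomorphic G H"
  shows "bicycle_weight G = bicycle_weight H"
proof -
  obtain f g where f: "bij_betw f (verts G) (verts H)" and g: "bij_betw g (edges G) (edges H)"
    and fg: "\<And>e. e \<in> edges G \<Longrightarrow> ends H (g e) = f ` ends G e"
    using assms(2) unfolding isomorphic_def by auto
  define T where "T y = (\<lambda>e. if e \<in> edges G then y (g e) else 0)" for y :: "'d \<Rightarrow> bit"
  define T' where "T' x = (\<lambda>e'. if e' \<in> edges H then x (inv_into (edges G) g e') else 0)"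
    for x :: "'b \<Rightarrow> bit"
  have g_in: "g e \<in> edges H" if "e \<in> edges G" for e using g that by (auto simp: bij_betw_def)
  have T_vecs: "T y \<in> vecs (edges G)" for y by (auto simp: T_def vecs_def)
  have T'_vecs: "T' x \<in> vecs (edges H)" for x by (auto simp: T'_def vecs_def)
  have TT': "T (T' x) = x" if "x \<in> vecs (edges G)" for x
    using that g g_in bij_betw_inv_into_left[OF g] by (auto simp: T_def T'_def vecs_def fun_eq_iff)
  have T'T: "T' (T y) = y" if "y \<in> vecs (edges H)" for y
  proof
    fix e'
    show "T' (T y) e' = y e'"
      using that bij_betw_inv_into_right[OF g, of e'] inv_into_into[of e' g "edges G"] g
      by (cases "e' \<in> edges H") (auto simp: T_def T'_def vecs_def bij_betw_def)
  qed
  have T_cut: "T y \<in> cut_space G \<longleftrightarrow> y \<in> cut_space H" if y: "y \<in> vecs (edges H)" for y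
  proof
    assume "y \<in> cut_space H"
    then obtain p where p: "\<And>e u v. e \<in> edges H \<Longrightarrow> ends H e = {u, v} \<Longrightarrow> y e = p u + p v"
      unfolding cut_space_def by blast
    have "T y e = p (f u) + p (f v)" if "e \<in> edges G" "ends G e = {u, v}" for e u v
      using p[OF g_in[OF that(1)], of "f u" "f v"] fg[OF that(1)] that by (simp add: T_def)
    then show "T y \<in> cut_space G"
      unfolding cut_space_def using T_vecs by (intro CollectI conjI exI[of _ "\<lambda>u. p (f u)"]) auto
  next
    assume "T y \<in> cut_space G"
    then obtain p where p: "\<And>e u v. e \<in> edges G \<Longrightarrow> ends G e = {u, v} \<Longrightarrow> T y e = p u + p v"
      unfolding cut_space_def by blast
    \<comment> \<open>\<open>f\<close> can be inverted on \<open>verts G\<close> only, so the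
      potential is transported correctly because \<open>multigraph G\<close> places the ends of
      every edge there.\<close>
    define q where "q u = p (inv_into (verts G) f u)" for u
    have "y e' = q u' + q v'" if e': "e' \<in> edges H" "ends H e' = {u', v'}" for e' u' v'
    proof -
      obtain e where e: "e \<in> edges G" "e' = g e" using g e'(1) by (auto simp: bij_betw_def)
      obtain u v where uv: "ends G e = {u, v}" "u \<in> verts G" "v \<in> verts G"
        using multigraph_ends[OF assms(1) e(1)] .
      have "y e' = q (f u) + q (f v)"
        using p[OF e(1) uv(1)] e uv bij_betw_inv_into_left[OF f] by (simp add: T_def q_def)
      moreover have "{f u, f v} = {u', v'}" using fg[OF e(1)] e'(2) e(2) uv(1) by simp
      ultimately show ?thesis by (auto simp: doubleton_eq_iff add.commute)
    qed
    then show "y \<in> cut_space H" using y unfolding cut_space_def by blast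
  qed
  have T_ip: "inner_product (edges G) (T x) (T y) = inner_product (edges H) x y" for x y
    using sum.reindex_bij_betw[OF g, of "\<lambda>e. x e * y e"]
    by (simp add: inner_product_def T_def cong: sum.cong)
  have T_perp: "T y \<in> perp (edges G) (cut_space G) \<longleftrightarrow> y \<in> perp (edges H) (cut_space H)"
    if y: "y \<in> vecs (edges H)" for y
  proof
    assume a: "T y \<in> perp (edges G) (cut_space G)"
    have "inner_product (edges H) u y = 0" if "u \<in> cut_space H" for u
      using a T_cut[of u] that cut_space_subset[of H] T_ip[of u y] by (auto simp: perp_def)
    then show "y \<in> perp (edges H) (cut_space H)" using y by (simp add: perp_def)
  next
    assume a: "y \<in> perp (edges H) (cut_space H)"
    have "inner_product (edges G) u (T y) = 0" if u: "u \<in> cut_space G" for u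
    proof -
      have "T (T' u) = u" using TT' u cut_space_subset by blast
      then have "T' u \<in> cut_space H" using T_cut[OF T'_vecs, of u] u by simp
      then show ?thesis using a T_ip[of "T' u" y] \<open>T (T' u) = u\<close> by (simp add: perp_def)
    qed
    then show "T y \<in> perp (edges G) (cut_space G)" using T_vecs by (simp add: perp_def)
  qed
  have "bij_betw T {y \<in> vecs (edges H). P y} {x \<in> vecs (edges G). Q x}"
    if "\<And>y. y \<in> vecs (edges H) \<Longrightarrow> Q (T y) \<longleftrightarrow> P y" for P Q
    by (rule bij_betw_byWitness[where f' = T'])
      (use that TT' T'T T_vecs T'_vecs in \<open>auto, metis\<close>)
  then have *: "card {y \<in> vecs (edges H). P y} = card {x \<in> vecs (edges G). Q x}"
    if "\<And>y. y \<in> vecs (edges H) \<Longrightarrow> Q (T y) \<longleftrightarrow> P y" for P Q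
    using that bij_betw_same_card by blast
  have "card {y \<in> vecs (edges H). y \<in> cut_space H} = card {x \<in> vecs (edges G). x \<in> cut_space G}"
    by (intro * T_cut)
  moreover have "card {y \<in> vecs (edges H). y \<in> bicycle_space H}
      = card {x \<in> vecs (edges G). x \<in> bicycle_space G}"
    by (intro *) (simp add: bicycle_space_def T_cut T_perp)
  moreover have "{x \<in> vecs (edges G). x \<in> cut_space G} = cut_space G"
      "{x \<in> vecs (edges H). x \<in> cut_space H} = cut_space H"
      "{x \<in> vecs (edges G). x \<in> bicycle_space G} = bicycle_space G"
      "{x \<in> vecs (edges H). x \<in> bicycle_space H} = bicycle_space H"
    using cut_space_subset by (auto simp: bicycle_space_def)
  ultimately show ?thesis
    using bij_betw_same_card[OF g] by (simp add: bicycle_weight_def)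
qed

text \<open>A cut vanishes on \<open>a\<close> iff its potential agrees at \<open>x\<close> and
  \<open>y\<close>, which is the condition for the potential to descend to the contracted graph; it
  then vanishes on all of \<open>F\<close>. Edges joining \<open>x\<close> and \<open>y\<close>
  outside \<open>F\<close> turn into loops, where a cut is 0 as well.\<close>

lemma cut_space_contract:
  assumes F: "a \<in> F" "F \<subseteq> edges G" "\<And>e. e \<in> F \<Longrightarrow> ends G e = {x, y}" and G: "multigraph G"
  shows "cut_space (contract G x y F) = {c \<in> cut_space G. c a = 0}"
proof -
  define m where "m u = (if u = y then x else u)" for u
  have C: "edges (contract G x y F) = edges G - F" "ends (contract G x y F) = (\<lambda>e. m ` ends G e)"
    by (auto simp: contract_def m_def)
  show ?thesis
  proof (intro equalityI subsetI)
    fix c assume c: "c \<in> cut_space (contract G x y F)"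
    then obtain p where p: "\<And>e u v. e \<in> edges G - F \<Longrightarrow> m ` ends G e = {u, v} \<Longrightarrow> c e = p u + p v"
      unfolding cut_space_def C by blast
    have c0: "c e = 0" if "e \<in> F \<or> e \<notin> edges G" for e
      using c that by (auto simp: cut_space_def C vecs_def)
    have "c e = p (m u) + p (m v)" if e: "e \<in> edges G" "ends G e = {u, v}" for e u v
    proof (cases "e \<in> F")
      case True
      then have "{u, v} = {x, y}" using F e by simp
      then show ?thesis using c0 True by (auto simp: doubleton_eq_iff m_def)
    qed (use p[of e "m u" "m v"] e in auto)
    then show "c \<in> {c \<in> cut_space G. c a = 0}"
      using c0 F unfolding cut_space_def vecs_def
      by (intro CollectI conjI exI[of _ "\<lambda>u. p (m u)"]) auto
  next
    fix c assume "c \<in> {c \<in> cut_space G. c a = 0}"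
    then obtain p where ca: "c a = 0" and cv: "c \<in> vecs (edges G)"
      and p: "\<And>e u v. e \<in> edges G \<Longrightarrow> ends G e = {u, v} \<Longrightarrow> c e = p u + p v"
      unfolding cut_space_def by blast
    have pxy: "p x = p y"
      using p[of a x y] F ca by (auto simp: bit_add_eq_0_iff)
    then have pm: "p (m u) = p u" for u by (simp add: m_def)
    have "c e = p u + p v" if e: "e \<in> edges G - F" "m ` ends G e = {u, v}" for e u v
    proof -
      have eG: "e \<in> edges G" using e by blast
      obtain u' v' where uv: "ends G e = {u', v'}" "u' \<in> verts G" "v' \<in> verts G"
        using multigraph_ends[OF G eG] .
      then have "c e = p (m u') + p (m v')" using p[OF eG uv(1)] pm by simp
      moreover have "{m u', m v'} = {u, v}" using e uv by simp
      ultimately show ?thesis by (auto simp: doubleton_eq_iff add.commute)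
    qed
    moreover have "c e = 0" if "e \<in> F" for e
      using p[of e x y] F that pxy by auto
    ultimately show "c \<in> cut_space (contract G x y F)"
      using cv unfolding cut_space_def C vecs_def by blast
  qed
qed

text \<open>Evaluation at \<open>a\<close> takes both values on \<open>U\<close>, because of 0 and
  \<open>s\<close>, so its kernel has index 2.\<close>

lemma card_subgroup_halve:
  fixes U :: "('a \<Rightarrow> bit) set"
  assumes "finite U" "additive_subgroup U" "s \<in> U" "s a = 1"
  shows "card U = 2 * card {u \<in> U. u a = 0}"
proof -
  have "(\<lambda>u. u a) ` U = {0, 1}"
    using assms additive_subgroup_zero[OF assms(2)] by (auto simp: image_iff) (metis zero_fun_apply)+
  then show ?thesis
    using card_eq_card_image_times_kernel[OF assms(1,2), of "\<lambda>u. u a"] by simp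
qed

text \<open>Here \<open>w\<close> is the interior vertex of the doubled path and \<open>z\<close>
  its neighbour away from the contracted pair. Allowing \<open>w\<close> to be either
  \<open>x\<close> or \<open>y\<close> covers contractions on both sides of it.\<close>

lemma bicycle_weight_contract:
  assumes G: "multigraph G"
    and ab: "a \<in> edges G" "b \<in> edges G" "a \<noteq> b" "ends G a = {x, y}" "ends G b = {x, y}"
    and cd: "c \<in> edges G" "d \<in> edges G" "c \<noteq> d" "ends G c = {w, z}" "ends G d = {w, z}"
    and w: "w \<in> {x, y}" "x \<noteq> y" "z \<notin> {x, y}" "degree G w = 4"
  shows "bicycle_weight (contract G x y {a, b}) = bicycle_weight G"
proof -
  let ?E = "edges G" and ?C = "cut_space G" and ?H = "contract G x y {a, b}"
  have fin: "finite ?E" using G by (simp add: multigraph_def)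
  have EH: "edges ?H = ?E - {a, b}" by (simp add: contract_def)
  have dist: "a \<noteq> c" "a \<noteq> d" "b \<noteq> c" "b \<noteq> d" using ab cd w by auto
  have ends_a: "\<exists>t. t \<noteq> w \<and> {x, y} = {w, t}" using w by auto
  \<comment> \<open>Four distinct edges at \<open>w\<close> are already known, and
    \<open>degree\<close> is at least the number of incident edges, so there are no others.\<close>
  have star: "{e \<in> ?E. w \<in> ends G e} = {a, b, c, d}"
  proof -
    have "{a, b, c, d} \<subseteq> {e \<in> ?E. w \<in> ends G e}" using ab cd w by auto
    moreover have "card {a, b, c, d} = 4" using ab cd dist by simp
    moreover have "card {e \<in> ?E. w \<in> ends G e} \<le> 4" using w by (simp add: degree_def)
    ultimately have "{a, b, c, d} = {e \<in> ?E. w \<in> ends G e}"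
      using fin by (intro card_seteq) auto
    then show ?thesis ..
  qed
  define s where "s e = (if e \<in> {a, b, c, d} then 1 else 0 :: bit)" for e
  have s_cut: "s \<in> ?C"
  proof -
    have "s e = (if u = w then 1 else 0) + (if v = w then 1 else 0)"
      if e: "e \<in> ?E" "ends G e = {u, v}" for e u v
    proof (cases "e \<in> {a, b, c, d}")
      case True
      then have "{u, v} = {x, y} \<or> {u, v} = {w, z}" using e ab cd by auto
      then show ?thesis using True w ends_a by (auto simp: s_def doubleton_eq_iff)
    next
      case False
      then have "w \<notin> {u, v}" using star e by auto
      then show ?thesis using False by (auto simp: s_def)
    qed
    moreover have "s \<in> vecs ?E" using ab cd by (auto simp: s_def vecs_def)
    ultimately show ?thesis
      unfolding cut_space_def by (intro CollectI conjI exI[of _ "\<lambda>u. if u = w then 1 else 0"]) auto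
  qed
  have cut_ab: "u a = u b" and cut_cd: "u c = u d" if u: "u \<in> ?C" for u
  proof -
    obtain p where p: "\<And>e t v. e \<in> ?E \<Longrightarrow> ends G e = {t, v} \<Longrightarrow> u e = p t + p v"
      using u unfolding cut_space_def by blast
    show "u a = u b" using p[OF ab(1,4)] p[OF ab(2,5)] by simp
    show "u c = u d" using p[OF cd(1,4)] p[OF cd(2,5)] by simp
  qed
  \<comment> \<open>Parallel edges have equal values in every cut, so the contributions of
    \<open>a\<close>, \<open>b\<close> cancel, and so do those of \<open>c\<close>,
    \<open>d\<close>.\<close>
  have s_perp: "s \<in> perp ?E ?C"
  proof -
    have "inner_product ?E u s = 0" if u: "u \<in> ?C" for u
    proof -
      have "inner_product ?E u s = (\<Sum>e\<in>{a, b, c, d}. u e * s e)"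
        unfolding inner_product_def using ab cd fin
        by (intro sum.mono_neutral_right) (auto simp: s_def)
      also have "\<dots> = 0"
        using ab cd dist cut_ab[OF u] cut_cd[OF u] by (simp add: s_def)
      finally show ?thesis .
    qed
    then show ?thesis using s_cut cut_space_subset[of G] by (auto simp: perp_def)
  qed
  have CH: "cut_space ?H = {u \<in> ?C. u a = 0}"
    using ab by (intro cut_space_contract G) auto
  have ip: "inner_product (edges ?H) u v = inner_product ?E u v" if "u \<in> cut_space ?H" for u v
  proof -
    have "u a = 0" "u b = 0" using that cut_ab[of u] unfolding CH by simp_all
    then show ?thesis
      unfolding inner_product_def EH using fin by (intro sum.mono_neutral_left) auto
  qed
  have BH: "bicycle_space ?H = {u \<in> bicycle_space G. u a = 0}"
  proof (intro equalityI subsetI)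
    fix u assume u: "u \<in> bicycle_space ?H"
    then have uC: "u \<in> ?C" "u a = 0" "u \<in> cut_space ?H" by (auto simp: bicycle_space_def CH)
    \<comment> \<open>Orthogonality to the cuts avoiding \<open>a\<close> has to be extended to all
      cuts. If \<open>v a = 1\<close>, then \<open>v + s\<close> avoids \<open>a\<close>, and the
      correction \<open>s\<close> is itself orthogonal to the cut \<open>u\<close>.\<close>
    have "inner_product ?E v u = 0" if v: "v \<in> ?C" for v
    proof (cases "v a = 0")
      case True
      then show ?thesis using u v ip by (auto simp: bicycle_space_def CH perp_def)
    next
      case False
      then have "v + s \<in> cut_space ?H"
        using v s_cut additive_subgroup_add[OF additive_subgroup_cut_space] by (auto simp: CH s_def)
      then have "inner_product ?E (v + s) u = 0"
        using u ip by (auto simp: bicycle_space_def perp_def)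
      moreover have "inner_product ?E s u = 0"
        using s_perp uC inner_product_commute[of ?E s u] by (simp add: perp_def)
      ultimately show ?thesis by (simp add: inner_product_add_left)
    qed
    then show "u \<in> {u \<in> bicycle_space G. u a = 0}"
      using uC cut_space_subset[of G] by (auto simp: bicycle_space_def perp_def)
  next
    fix u assume u: "u \<in> {u \<in> bicycle_space G. u a = 0}"
    then have "u \<in> cut_space ?H" by (auto simp: bicycle_space_def CH)
    moreover have "inner_product (edges ?H) v u = 0" if "v \<in> cut_space ?H" for v
      using u that ip[OF that] by (auto simp: bicycle_space_def CH perp_def)
    ultimately show "u \<in> bicycle_space ?H"
      using cut_space_subset[of ?H] by (auto simp: bicycle_space_def perp_def)
  qed
  have sa: "s a = 1" by (simp add: s_def)
  have "finite ?C" using finite_cut_space[OF fin] .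
  then have "card ?C = 2 * card (cut_space ?H)"
    unfolding CH by (rule card_subgroup_halve[OF _ additive_subgroup_cut_space s_cut sa])
  moreover have "card (bicycle_space G) = 2 * card (bicycle_space ?H)"
    unfolding BH using card_subgroup_halve[OF _ additive_subgroup_bicycle_space, of G s a]
      \<open>finite ?C\<close> s_cut s_perp sa by (simp add: bicycle_space_def)
  moreover have "card ?E = card (edges ?H) + 2"
    using ab fin card_Diff_subset[of "{a, b}" ?E] card_mono[of ?E "{a, b}"] by (simp add: EH)
  ultimately show ?thesis by (simp add: bicycle_weight_def power_add)
qed

lemma multigraph_contract:
  assumes "multigraph G" "x \<in> verts G" "x \<noteq> y"
  shows "multigraph (contract G x y F)"
proof -
  define m where "m u = (if u = y then x else u)" for u
  have "m ` ends G e \<subseteq> verts G - {y} \<and> card (m ` ends G e) \<in> {1, 2}" if "e \<in> edges G" for e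
  proof -
    obtain u v where uv: "ends G e = {u, v}" "u \<in> verts G" "v \<in> verts G"
      using multigraph_ends[OF assms(1) \<open>e \<in> edges G\<close>] .
    have "m ` ends G e = {m u, m v}" using uv by simp
    moreover have "{m u, m v} \<subseteq> verts G - {y}" using uv assms by (auto simp: m_def)
    ultimately show ?thesis by (simp add: card_insert_if)
  qed
  then show ?thesis
    using assms(1) by (simp add: multigraph_def contract_def m_def)
qed

lemma doubled_path_contraction_invariant:
  assumes "doubled_path_contraction G H"
  shows "multigraph G" "multigraph H" "bicycle_weight H = bicycle_weight G"
proof -
  show G: "multigraph G" using assms by (simp add: doubled_path_contraction_def)
  obtain k v e1 e2 i where k: "2 \<le> k" and path: "doubled_path G k v e1 e2" and i: "i \<in> {1..k}"
    and iso: "isomorphic (contract G (v (i - 1)) (v i) {e1 i, e2 i}) H"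
    using assms unfolding doubled_path_contraction_def by blast
  have v: "v j \<in> verts G" if "j \<le> k" for j
    using path that unfolding doubled_path_def by auto
  have inj: "v j \<noteq> v l" if "j \<le> k" "l \<le> k" "j \<noteq> l" for j l
    using path that unfolding doubled_path_def inj_on_def by auto
  have e: "e1 j \<in> edges G" "e2 j \<in> edges G" "e1 j \<noteq> e2 j"
    "ends G (e1 j) = {v (j - 1), v j}" "ends G (e2 j) = {v (j - 1), v j}" if "j \<in> {1..k}" for j
    using path that unfolding doubled_path_def by blast+
  have deg: "degree G (v j) = 4" if "j \<in> {1..<k}" for j
    using path that unfolding doubled_path_def by blast
  have mH: "multigraph (contract G (v (i - 1)) (v i) {e1 i, e2 i})"
    using i v inj by (intro multigraph_contract G) auto
  show "multigraph H" by (rule multigraph_isomorphic[OF mH iso])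
  have "bicycle_weight (contract G (v (i - 1)) (v i) {e1 i, e2 i}) = bicycle_weight G"
  \<comment> \<open>An interior end of the contracted pair is required. If \<open>i < k\<close> it
    is \<open>v i\<close>, with the next pair as \<open>c\<close>, \<open>d\<close>; if
    \<open>i = k\<close> it is \<open>v (k - 1)\<close>, with the previous pair, which exists
    because \<open>2 \<le> k\<close>.\<close>
  proof (cases "i < k")
    case True
    have "Suc i \<in> {1..k}" using True i by auto
    from e[OF this] show ?thesis
      using True i inj deg[of i]
      by (intro bicycle_weight_contract[OF G e[OF i], where c = "e1 (Suc i)" and d = "e2 (Suc i)"
            and w = "v i" and z = "v (Suc i)"]) auto
  next
    case False
    then have i': "i - 1 \<in> {1..k}" "i - 1 \<in> {1..<k}" "i = k" using i k by auto
    from e[OF i'(1)] show ?thesis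
      using i' inj deg[OF i'(2)] k
      by (intro bicycle_weight_contract[OF G e[OF i], where c = "e1 (i - 1)" and d = "e2 (i - 1)"
            and w = "v (i - 1)" and z = "v (i - 1 - 1)"]) (auto simp: insert_commute)
  qed
  then show "bicycle_weight H = bicycle_weight G"
    using bicycle_weight_isomorphic[OF mH iso] by simp
qed

lemma doubled_path_equivalent_bicycle_weight:
  assumes "multigraph G1" "doubled_path_equivalent G1 G2"
  shows "bicycle_weight G1 = bicycle_weight G2"
proof -
  obtain H1 H2 :: "(nat, nat) mgraph" where 1: "isomorphic G1 H1" and 2: "isomorphic H2 G2"
    and eq: "equivclp doubled_path_contraction H1 H2"
    using assms(2) unfolding doubled_path_equivalent_def by blast
  \<comment> \<open>Steps go in both directions. A contraction makes both of its graphs multigraphs,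
    so this property travels along extensions too.\<close>
  from eq have "multigraph H2 \<and> bicycle_weight H2 = bicycle_weight H1"
  proof (induction rule: equivclp_induct)
    case base
    then show ?case using multigraph_isomorphic[OF assms(1) 1] by simp
  next
    case (step y z)
    then show ?case using doubled_path_contraction_invariant by metis
  qed
  then show ?thesis
    using bicycle_weight_isomorphic[OF assms(1) 1] bicycle_weight_isomorphic[OF _ 2] by simp
qed

section \<open>Cohomology of a spherical diagram\<close>

lemma orbit_subset_closed:
  assumes "\<And>a. a \<in> C \<Longrightarrow> f a \<in> C" "a \<in> C"
  shows "orbit f a \<subseteq> C"
proof
  fix b assume "b \<in> orbit f a"
  then show "b \<in> C" by induction (use assms in auto)
qed

text \<open>Orbits started in different blocks stay in them and hence differ. This lets Euler's
  formula be summed over the components.\<close>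

lemma card_orbits_blocks:
  assumes "finite S" "partition_on S P" and closed: "\<And>C a. C \<in> P \<Longrightarrow> a \<in> C \<Longrightarrow> f a \<in> C"
  shows "card (orbit f ` S) = (\<Sum>C\<in>P. card (orbit f ` C))"
proof -
  have S: "S = \<Union>P" using partition_onD1[OF assms(2)] .
  have "orbit f ` C \<inter> orbit f ` C' = {}" if C: "C \<in> P" "C' \<in> P" "C \<noteq> C'" for C C'
  proof -
    have "C \<inter> C' = {}" using disjointD[OF partition_onD2[OF assms(2)] C] .
    moreover have "orbit f a \<subseteq> C" if "a \<in> C" for a
      by (rule orbit_subset_closed[OF closed[OF C(1)] that])
    moreover have "orbit f a \<subseteq> C'" if "a \<in> C'" for a
      by (rule orbit_subset_closed[OF closed[OF C(2)] that])
    ultimately have "orbit f a \<noteq> orbit f b" if "a \<in> C" "b \<in> C'" for a b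
      using that orbit_nonempty[of f a] by (metis Int_greatest subset_empty)
    then show ?thesis by blast
  qed
  moreover have "finite C" if "C \<in> P" for C using assms(1) S that by (auto intro: finite_subset)
  ultimately have "card (\<Union>C\<in>P. orbit f ` C) = (\<Sum>C\<in>P. card (orbit f ` C))"
    using finite_elements[OF assms(1,2)] by (intro card_UN_disjoint) auto
  moreover have "(\<Union>C\<in>P. orbit f ` C) = orbit f ` S" using S by blast
  ultimately show ?thesis by simp
qed

text \<open>A corner is represented by the dart that precedes it counterclockwise; this is the step to the
  next corner along the same face.\<close>

definition corner_step :: "'d diagram \<Rightarrow> 'd \<Rightarrow> 'd" where
  "corner_step D = opp D \<circ> rot D"

locale spherical_diagram =
  fixes D :: "'d diagram"
  assumes link_diagram: "link_diagram D"
begin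

abbreviation "\<Delta> \<equiv> darts D"
abbreviation "\<alpha> \<equiv> opp D"
abbreviation "\<rho> \<equiv> rot D"
abbreviation "\<phi> \<equiv> corner_step D"
abbreviation "Inv \<equiv> invariant_vecs (darts D)"

lemma finite_darts: "finite \<Delta>"
  and opp_permutes: "\<alpha> permutes \<Delta>"
  and rot_permutes: "\<rho> permutes \<Delta>"
  and opp_neq: "d \<in> \<Delta> \<Longrightarrow> \<alpha> d \<noteq> d"
  and card_rot_orbit: "d \<in> \<Delta> \<Longrightarrow> card (orbit \<rho> d) = 4"
  and over_rot: "d \<in> \<Delta> \<Longrightarrow> over D (\<rho> d) \<longleftrightarrow> \<not> over D d"
  and euler_component: "C \<in> crossing_components D \<Longrightarrow>
    int (card (orbit \<rho> ` C)) - int (card (orbit \<alpha> ` C)) + int (card (orbit (face_step D) ` C)) = 2"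
  using link_diagram unfolding link_diagram_def by blast+

lemma opp_opp [simp]: "\<alpha> (\<alpha> d) = d"
  using link_diagram by (cases "d \<in> \<Delta>") (auto simp: link_diagram_def permutes_def)

lemma opp_in [simp]: "\<alpha> d \<in> \<Delta> \<longleftrightarrow> d \<in> \<Delta>"
  using permutes_in_image[OF opp_permutes] .

lemma rot_in [simp]: "\<rho> d \<in> \<Delta> \<longleftrightarrow> d \<in> \<Delta>"
  using permutes_in_image[OF rot_permutes] .

lemma face_step_permutes: "face_step D permutes \<Delta>"
proof -
  have "face_step D = \<rho> \<circ> \<alpha>" by (auto simp: face_step_def)
  then show ?thesis using opp_permutes rot_permutes by (simp add: permutes_compose)
qed

lemma corner_step_permutes: "\<phi> permutes \<Delta>"
  unfolding corner_step_def using opp_permutes rot_permutes by (simp add: permutes_compose)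

lemma inv_rot_permutes: "inv \<rho> permutes \<Delta>"
  using permutes_inv[OF rot_permutes] .

lemma rot_inv_rot [simp]: "\<rho> (inv \<rho> d) = d" "inv \<rho> (\<rho> d) = d"
  using permutes_inverses[OF rot_permutes] by auto

lemma inv_rot_in [simp]: "inv \<rho> d \<in> \<Delta> \<longleftrightarrow> d \<in> \<Delta>"
  using permutes_in_image[OF inv_rot_permutes] .

lemma over_inv_rot: "d \<in> \<Delta> \<Longrightarrow> over D (inv \<rho> d) \<longleftrightarrow> \<not> over D d"
  using over_rot[of "inv \<rho> d"] by simp

lemma finite_Inv: "finite (Inv f)"
  using finite_subset[OF invariant_vecs_subset finite_vecs[OF finite_darts]] .

section \<open>Dart counts and Euler's formula for the whole diagram\<close>

lemma card_darts_opp: "card \<Delta> = 2 * card (orbit \<alpha> ` \<Delta>)"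
proof -
  note part = partition_on_orbits[OF opp_permutes finite_darts]
  have "orbit \<alpha> d = {d, \<alpha> d}" for d
  proof (intro equalityI)
    show "orbit \<alpha> d \<subseteq> {d, \<alpha> d}" by (rule orbit_subset_closed) auto
    show "{d, \<alpha> d} \<subseteq> orbit \<alpha> d"
      using permutes_self_in_orbit[OF opp_permutes finite_darts] by (auto intro: orbit.base)
  qed
  moreover have "card {d, \<alpha> d} = 2" if "d \<in> \<Delta>" for d
    using opp_neq[OF that] by (metis card_2_iff)
  ultimately have "card B = 2" if "B \<in> orbit \<alpha> ` \<Delta>" for B
    using that by auto
  then have "2 * card (orbit \<alpha> ` \<Delta>) = card (\<Union>(orbit \<alpha> ` \<Delta>))"
    using finite_darts partition_onD1[OF part, symmetric] disjointD[OF partition_onD2[OF part]]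
    by (intro card_partition) auto
  then show ?thesis using partition_onD1[OF part] by simp
qed

lemma card_darts_rot: "card \<Delta> = 4 * num_crossings D"
proof -
  note part = partition_on_orbits[OF rot_permutes finite_darts]
  have "4 * card (orbit \<rho> ` \<Delta>) = card (\<Union>(orbit \<rho> ` \<Delta>))"
    using finite_darts partition_onD1[OF part, symmetric] disjointD[OF partition_onD2[OF part]]
      card_rot_orbit
    by (intro card_partition) auto
  then show ?thesis using partition_onD1[OF part] by (simp add: num_crossings_def)
qed

lemma euler:
  "num_crossings D + card (orbit (face_step D) ` \<Delta>)
    = card (orbit \<alpha> ` \<Delta>) + 2 * card (crossing_components D)"
proof -
  let ?P = "crossing_components D"
  have part: "partition_on \<Delta> ?P"
    unfolding crossing_components_def by (rule partition_on_classes_of)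
  have closed: "\<alpha> a \<in> C" "\<rho> a \<in> C" if "C \<in> ?P" "a \<in> C" for C a
  proof -
    have "a \<in> \<Delta>" using partition_onD1[OF part] that by blast
    then show "\<alpha> a \<in> C" "\<rho> a \<in> C"
      using that unfolding crossing_components_def by (auto elim!: classes_of_closed)
  qed
  note orb = card_orbits_blocks[OF finite_darts part]
  have c: "int (num_crossings D) = (\<Sum>C\<in>?P. int (card (orbit \<rho> ` C)))"
    unfolding num_crossings_def using orb[of \<rho>] closed by simp
  have e: "int (card (orbit \<alpha> ` \<Delta>)) = (\<Sum>C\<in>?P. int (card (orbit \<alpha> ` C)))"
    using orb[of \<alpha>] closed by simp
  have f: "int (card (orbit (face_step D) ` \<Delta>)) = (\<Sum>C\<in>?P. int (card (orbit (face_step D) ` C)))"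
    using orb[of "face_step D"] closed by (simp add: face_step_def)
  have "int (num_crossings D) - int (card (orbit \<alpha> ` \<Delta>)) + int (card (orbit (face_step D) ` \<Delta>))
      = (\<Sum>C\<in>?P. 2)"
    unfolding c e f using euler_component by (simp flip: sum_subtractf sum.distrib)
  then show ?thesis by simp
qed

text \<open>Components are generated by \<open>opp\<close> and \<open>rot\<close>, so invariance
  under both is constancy on components.\<close>

lemma card_Inv_opp_Int_Inv_rot: "card (Inv \<alpha> \<inter> Inv \<rho>) = 2 ^ card (crossing_components D)"
proof -
  have "Inv \<alpha> \<inter> Inv \<rho> = respecting \<Delta> (\<lambda>d e. e = \<alpha> d \<or> e = \<rho> d)"
  proof (intro equalityI subsetI)
    fix x assume x: "x \<in> respecting \<Delta> (\<lambda>d e. e = \<alpha> d \<or> e = \<rho> d)"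
    have "x (\<alpha> d) = x d" "x (\<rho> d) = x d" if d: "d \<in> \<Delta>" for d
    proof -
      have "\<alpha> d \<in> \<Delta>" "\<rho> d \<in> \<Delta>" using d by simp_all
      then have a: "x d = x (\<alpha> d)" "x d = x (\<rho> d)"
        using x d unfolding respecting_def by blast+
      show "x (\<alpha> d) = x d" "x (\<rho> d) = x d" by (fact a[symmetric])+
    qed
    then show "x \<in> Inv \<alpha> \<inter> Inv \<rho>" using x unfolding invariant_vecs_def respecting_def by simp
  qed (auto simp: invariant_vecs_def respecting_def)
  then show ?thesis
    using card_respecting[OF finite_darts] by (simp add: crossing_components_def)
qed

text \<open>\<open>corner_step\<close> is \<open>opp\<close> after \<open>rot\<close> and
  \<open>face_step\<close> is \<open>rot\<close> after \<open>opp\<close>; conjugation by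
  \<open>opp\<close> exchanges them and carries invariant functions to invariant functions.\<close>

lemma card_orbits_corner_step: "card (orbit \<phi> ` \<Delta>) = card (orbit (face_step D) ` \<Delta>)"
proof -
  have "bij_betw (\<lambda>q. q \<circ> \<alpha>) (Inv \<phi>) (Inv (face_step D))"
  proof (rule bij_betw_byWitness[where f' = "\<lambda>q. q \<circ> \<alpha>"])
    show "(\<lambda>q. q \<circ> \<alpha>) ` Inv \<phi> \<subseteq> Inv (face_step D)"
    proof (rule image_subsetI)
      fix q assume q: "q \<in> Inv \<phi>"
      have "q (\<alpha> (\<rho> (\<alpha> d))) = q (\<alpha> d)" for d
        using invariant_vecs_apply[OF corner_step_permutes q, of "\<alpha> d"] by (simp add: corner_step_def)
      then show "q \<circ> \<alpha> \<in> Inv (face_step D)"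
        using q vecs_comp_permutes[OF opp_permutes] by (auto simp: invariant_vecs_def face_step_def)
    qed
    show "(\<lambda>q. q \<circ> \<alpha>) ` Inv (face_step D) \<subseteq> Inv \<phi>"
    proof (rule image_subsetI)
      fix q assume q: "q \<in> Inv (face_step D)"
      have "q (\<rho> d) = q (\<alpha> d)" for d
        using invariant_vecs_apply[OF face_step_permutes q, of "\<alpha> d"] by (simp add: face_step_def)
      then show "q \<circ> \<alpha> \<in> Inv \<phi>"
        using q vecs_comp_permutes[OF opp_permutes] by (auto simp: invariant_vecs_def corner_step_def)
    qed
  qed auto
  then have "card (Inv \<phi>) = card (Inv (face_step D))" by (rule bij_betw_same_card)
  then show ?thesis
    using card_invariant_vecs[OF corner_step_permutes finite_darts]
      card_invariant_vecs[OF face_step_permutes finite_darts] by simp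
qed

text \<open>Any two of \<open>opp\<close>, \<open>rot\<close> and \<open>corner_step\<close>
  generate the third.\<close>

lemma Inv_corner_step_Int:
  "Inv \<alpha> \<inter> Inv \<phi> = Inv \<alpha> \<inter> Inv \<rho>" "Inv \<phi> \<inter> Inv \<rho> = Inv \<alpha> \<inter> Inv \<rho>"
proof -
  have 1: "x \<in> Inv \<alpha> \<Longrightarrow> x \<in> Inv \<phi> \<longleftrightarrow> x \<in> Inv \<rho>" for x
    using invariant_vecs_apply[OF opp_permutes, of x]
    by (auto simp: invariant_vecs_def corner_step_def)
  have 2: "x \<in> Inv \<rho> \<Longrightarrow> x \<in> Inv \<phi> \<Longrightarrow> x \<in> Inv \<alpha>" for x
  proof -
    assume x: "x \<in> Inv \<rho>" "x \<in> Inv \<phi>"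
    have "x (\<alpha> d) = x d" for d
      using invariant_vecs_apply[OF corner_step_permutes x(2), of "inv \<rho> d"]
        invariant_vecs_apply[OF rot_permutes x(1), of "inv \<rho> d"] by (simp add: corner_step_def)
    then show "x \<in> Inv \<alpha>" using x by (auto simp: invariant_vecs_def)
  qed
  show "Inv \<alpha> \<inter> Inv \<phi> = Inv \<alpha> \<inter> Inv \<rho>" "Inv \<phi> \<inter> Inv \<rho> = Inv \<alpha> \<inter> Inv \<rho>"
    using 1 2 by blast+
qed

lemma Inv_inv_rot: "Inv (inv \<rho>) = Inv \<rho>"
proof (intro equalityI subsetI)
  fix x assume x: "x \<in> Inv (inv \<rho>)"
  have "x (\<rho> d) = x d" for d using invariant_vecs_apply[OF inv_rot_permutes x, of "\<rho> d"] by simp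
  then show "x \<in> Inv \<rho>" using x by (auto simp: invariant_vecs_def)
next
  fix x assume x: "x \<in> Inv \<rho>"
  have "x (inv \<rho> d) = x d" for d using invariant_vecs_apply[OF rot_permutes x, of "inv \<rho> d"] by simp
  then show "x \<in> Inv (inv \<rho>)" using x by (auto simp: invariant_vecs_def)
qed

lemma card_orbits_inv_rot: "card (orbit (inv \<rho>) ` \<Delta>) = card (orbit \<rho> ` \<Delta>)"
proof -
  have "(2 :: nat) ^ card (orbit (inv \<rho>) ` \<Delta>) = 2 ^ card (orbit \<rho> ` \<Delta>)"
    using card_invariant_vecs[OF inv_rot_permutes finite_darts]
      card_invariant_vecs[OF rot_permutes finite_darts] unfolding Inv_inv_rot by (rule trans[OF sym])
  then show ?thesis by simp
qed

text \<open>Orthogonality to the indicator of an edge forces equal values at its two darts. As every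
  edge has exactly two darts, the space has half the full dimension and thus equals its
  complement.\<close>

lemma perp_Inv_opp: "perp \<Delta> (Inv \<alpha>) = Inv \<alpha>"
proof (rule card_subset_eq[OF finite_Inv])
  show "perp \<Delta> (Inv \<alpha>) \<subseteq> Inv \<alpha>"
  proof
    fix x assume x: "x \<in> perp \<Delta> (Inv \<alpha>)"
    have "x (\<alpha> d) = x d" if d: "d \<in> \<Delta>" for d
    proof -
      let ?u = "\<lambda>e. if e \<in> {d, \<alpha> d} then 1 else 0 :: bit"
      have "\<alpha> e = d \<longleftrightarrow> e = \<alpha> d" for e by auto
      moreover have "\<alpha> e = \<alpha> d \<longleftrightarrow> e = d" for e by (metis opp_opp)
      ultimately have "?u \<in> Inv \<alpha>" using d by (auto simp: invariant_vecs_def vecs_def)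
      then have "inner_product \<Delta> ?u x = 0" using x by (simp add: perp_def)
      moreover have "inner_product \<Delta> ?u x = (\<Sum>e\<in>{d, \<alpha> d}. x e)"
        unfolding inner_product_def using d finite_darts
        by (intro sum.mono_neutral_cong_right) auto
      ultimately show ?thesis
        using opp_neq[OF d] not_sym[OF opp_neq[OF d]] by (simp add: bit_add_eq_0_iff)
    qed
    then show "x \<in> Inv \<alpha>" using x perp_subset[of \<Delta>] by (auto simp: invariant_vecs_def)
  qed
  have "card (Inv \<alpha>) * card (perp \<Delta> (Inv \<alpha>)) = card (Inv \<alpha>) * card (Inv \<alpha>)"
    using card_times_card_perp[OF finite_darts
        additive_subgroup_invariant_vecs[of \<Delta> \<alpha>] invariant_vecs_subset]
      card_invariant_vecs[OF opp_permutes finite_darts] card_darts_opp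
    by (simp add: mult_2 power_add)
  then show "card (perp \<Delta> (Inv \<alpha>)) = card (Inv \<alpha>)"
    using card_invariant_vecs[OF opp_permutes finite_darts] by simp
qed

text \<open>Functions on edges are the \<open>opp\<close>-invariant functions on darts; those
  summing to zero around every face are the coboundaries of functions on crossings. The hypermap
  lemma applies with product \<open>\<alpha> \<circ> \<phi> = \<rho>\<close>, and
  \<open>Inv \<alpha>\<close> is its own complement.\<close>

lemma cocycle_space:
  "Inv \<alpha> \<inter> perp \<Delta> (Inv \<phi>) = {y + (y \<circ> \<alpha>) |y. y \<in> Inv \<rho>}"
proof -
  have comp: "\<alpha> \<circ> \<phi> = \<rho>" by (auto simp: corner_step_def)
  have "perp \<Delta> (Inv \<alpha>) \<inter> perp \<Delta> (Inv \<phi>) = {y + (y \<circ> \<alpha>) |y. y \<in> Inv (\<alpha> \<circ> \<phi>)}"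
  proof (rule perp_invariant_vecs_Int[OF finite_darts opp_permutes corner_step_permutes])
    show "card (Inv \<alpha> \<inter> Inv \<phi>) = 2 ^ card (crossing_components D)"
      by (simp add: Inv_corner_step_Int card_Inv_opp_Int_Inv_rot)
    show "card (orbit \<alpha> ` \<Delta>) + card (orbit \<phi> ` \<Delta>) + card (orbit (\<alpha> \<circ> \<phi>) ` \<Delta>)
        = card \<Delta> + 2 * card (crossing_components D)"
      using euler card_darts_opp by (simp add: comp card_orbits_corner_step num_crossings_def)
  qed
  then show ?thesis by (simp add: perp_Inv_opp comp)
qed

text \<open>Vertices and faces of the diagram are the vertices of a quadrangulation of the sphere whose
  edges are the corners and whose quadrilaterals are the edges of the diagram.\<close>

lemma corner_function_decomposition:
  assumes "h \<in> vecs \<Delta>" "h + (h \<circ> inv \<rho>) \<in> Inv \<alpha>"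
  obtains p q where "p \<in> Inv \<rho>" "q \<in> Inv \<phi>" "h = p + q"
proof -
  let ?U = "{u + v |u v. u \<in> Inv \<phi> \<and> v \<in> Inv (inv \<rho>)}"
  note sub = additive_subgroup_invariant_vecs
  have comp: "\<phi> \<circ> inv \<rho> = \<alpha>" by (auto simp: corner_step_def)
  have "perp \<Delta> ?U = perp \<Delta> (Inv \<phi>) \<inter> perp \<Delta> (Inv (inv \<rho>))"
    by (rule perp_sum[OF sub sub])
  also have "\<dots> = {y + (y \<circ> \<phi>) |y. y \<in> Inv (\<phi> \<circ> inv \<rho>)}"
  proof (rule perp_invariant_vecs_Int[OF finite_darts corner_step_permutes inv_rot_permutes])
    show "card (Inv \<phi> \<inter> Inv (inv \<rho>)) = 2 ^ card (crossing_components D)"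
      by (simp add: Inv_inv_rot Inv_corner_step_Int card_Inv_opp_Int_Inv_rot)
    show "card (orbit \<phi> ` \<Delta>) + card (orbit (inv \<rho>) ` \<Delta>) + card (orbit (\<phi> \<circ> inv \<rho>) ` \<Delta>)
        = card \<Delta> + 2 * card (crossing_components D)"
      using euler card_darts_opp
      by (simp add: comp card_orbits_corner_step card_orbits_inv_rot num_crossings_def)
  qed
  finally have U: "perp \<Delta> ?U = {y + (y \<circ> \<phi>) |y. y \<in> Inv \<alpha>}" unfolding comp .
  \<comment> \<open>For \<open>opp\<close>-invariant y the shift by \<open>corner_step\<close> is a
    shift by \<open>rot\<close>, which can be moved onto h. What remains is the pairing of y with
    \<open>h + (h \<circ> inv \<rho>)\<close>, and both lie in the self-orthogonal space
    \<open>Inv \<alpha>\<close>.\<close>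
  have "inner_product \<Delta> (y + (y \<circ> \<phi>)) h = 0" if y: "y \<in> Inv \<alpha>" for y
  proof -
    have "y \<circ> \<phi> = y \<circ> \<rho>"
      using invariant_vecs_apply[OF opp_permutes y] by (auto simp: corner_step_def)
    moreover have "(h \<circ> inv \<rho>) \<circ> \<rho> = h" by auto
    ultimately have "inner_product \<Delta> (y \<circ> \<phi>) h = inner_product \<Delta> y (h \<circ> inv \<rho>)"
      using inner_product_comp_permutes[OF rot_permutes, of y "h \<circ> inv \<rho>"] by metis
    moreover have "inner_product \<Delta> y (h + (h \<circ> inv \<rho>)) = 0"
      using assms(2) y perp_Inv_opp by (metis (mono_tags, lifting) mem_Collect_eq perp_def)
    ultimately show ?thesis by (simp add: inner_product_add_left inner_product_add_right)
  qed
  then have "h \<in> perp \<Delta> (perp \<Delta> ?U)" using assms(1) unfolding U by (auto simp: perp_def)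
  moreover have "?U \<subseteq> vecs \<Delta>"
    using invariant_vecs_subset[of \<Delta>] additive_subgroup_add[OF additive_subgroup_vecs[of \<Delta>]] by blast
  from this have "perp \<Delta> (perp \<Delta> ?U) = ?U"
    by (rule perp_perp[OF finite_darts additive_subgroup_sum[OF sub sub]])
  ultimately have "h \<in> ?U" by simp
  then obtain q p where "q \<in> Inv \<phi>" "p \<in> Inv \<rho>" "h = q + p"
    unfolding Inv_inv_rot by blast
  then show thesis using that[of p q] by (simp add: add.commute)
qed

section \<open>The decomposition graph of a spherical diagram\<close>

abbreviation "M \<equiv> marked_points D"
abbreviation "G \<equiv> alternating_decomposition_graph D"

definition curve_of :: "'d \<Rightarrow> 'd set" where
  "curve_of d = (THE \<gamma>. \<gamma> \<in> curves D \<and> d \<in> \<gamma>)"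

lemma marked_iff: "d \<in> M \<longleftrightarrow> d \<in> \<Delta> \<and> nonalternating D d"
  by (auto simp: marked_points_def)

lemma nonalternating_opp [simp]: "nonalternating D (\<alpha> d) \<longleftrightarrow> nonalternating D d"
  by (auto simp: nonalternating_def)

lemma opp_marked [simp]: "\<alpha> d \<in> M \<longleftrightarrow> d \<in> M"
  by (simp add: marked_iff)

lemma finite_marked: "finite M"
  using finite_subset[OF _ finite_darts] by (auto simp: marked_points_def)

lemma edges_G: "edges G = (\<lambda>d. {d, \<alpha> d}) ` M"
  by (auto simp: alternating_decomposition_graph_def marked_iff)

lemma partition_on_curves: "partition_on M (curves D)"
  unfolding curves_def by (rule partition_on_classes_of)

lemma curve_unique: "\<gamma> \<in> curves D \<Longrightarrow> d \<in> \<gamma> \<Longrightarrow> \<gamma>' \<in> curves D \<Longrightarrow> d \<in> \<gamma>' \<Longrightarrow> \<gamma> = \<gamma>'"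
  using disjointD[OF partition_onD2[OF partition_on_curves]] by blast

lemma curve_of_eq: "\<gamma> \<in> curves D \<Longrightarrow> d \<in> \<gamma> \<Longrightarrow> curve_of d = \<gamma>"
  unfolding curve_of_def by (rule the_equality) (use curve_unique in blast)+

lemma curve_of: "d \<in> M \<Longrightarrow> curve_of d \<in> curves D" "d \<in> M \<Longrightarrow> d \<in> curve_of d"
  using partition_onD1[OF partition_on_curves] curve_of_eq by blast+

lemma curve_of_arc:
  assumes "arc D d e"
  shows "curve_of d = curve_of e"
proof -
  have "d \<in> M" "e \<in> M" using assms by (auto simp: arc_def)
  then have "e \<in> curve_of d"
    using classes_of_closed[of "curve_of d" M "arc D" d e] curve_of assms by (simp add: curves_def)
  then show ?thesis using curve_of_eq[OF curve_of(1)] \<open>d \<in> M\<close> by simp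
qed

lemma ends_G: "d \<in> M \<Longrightarrow> ends G {d, \<alpha> d} = {curve_of d, curve_of (\<alpha> d)}"
  using curve_of curve_of_eq by (auto simp: alternating_decomposition_graph_def)

lemma finite_edges_G: "finite (edges G)"
  unfolding edges_G using finite_marked by simp

lemma multigraph_G: "multigraph G"
proof -
  have "finite (curves D)" using finite_elements[OF finite_marked partition_on_curves] .
  moreover have "finite (crossing_components D)"
    unfolding crossing_components_def
    using finite_elements[OF finite_darts partition_on_classes_of] .
  moreover have "finite (circles D)" using link_diagram by (simp add: link_diagram_def)
  ultimately have "finite (verts G)" by (simp add: alternating_decomposition_graph_def)
  moreover have "ends G e \<subseteq> verts G \<and> card (ends G e) \<in> {1, 2}" if "e \<in> edges G" for e
  proof -
    obtain d where d: "d \<in> M" "e = {d, \<alpha> d}" using \<open>e \<in> edges G\<close> unfolding edges_G by blast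
    have "curve_of d \<in> verts G" "curve_of (\<alpha> d) \<in> verts G"
      using curve_of(1) d by (simp_all add: alternating_decomposition_graph_def)
    then show ?thesis using d by (simp add: ends_G card_insert_if)
  qed
  ultimately show ?thesis using finite_edges_G by (simp add: multigraph_def)
qed

text \<open>Extends an edge function of the decomposition graph by 0 to all edges of the diagram,
  written on darts.\<close>

definition dart_lift :: "('d set \<Rightarrow> bit) \<Rightarrow> 'd \<Rightarrow> bit" where
  "dart_lift x d = (if d \<in> M then x {d, \<alpha> d} else 0)"

text \<open>The two darts of an edge represent corners on its two sides, so for q in
  \<open>Inv \<phi>\<close>, a function on faces, this is the coboundary in the dual graph,
  restricted to non-alternating edges.\<close>

definition edge_coboundary :: "('d \<Rightarrow> bit) \<Rightarrow> 'd set \<Rightarrow> bit" where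
  "edge_coboundary q e = (if e \<in> edges G then \<Sum>d\<in>e. q d else 0)"

lemma edge_coboundary_apply: "d \<in> M \<Longrightarrow> edge_coboundary q {d, \<alpha> d} = q d + q (\<alpha> d)"
  using opp_neq[of d] by (auto simp: edge_coboundary_def edges_G marked_iff)

lemma edge_coboundary_in_vecs: "edge_coboundary q \<in> vecs (edges G)"
  by (simp add: edge_coboundary_def vecs_def)

lemma edge_coboundary_diff: "edge_coboundary (p - q) = edge_coboundary p - edge_coboundary q"
  by (auto simp: edge_coboundary_def fun_eq_iff sum.distrib)

text \<open>Adjointness of \<open>edge_coboundary\<close> and \<open>dart_lift\<close>: the sum over
  darts is grouped by edges.\<close>

lemma inner_product_edge_coboundary:
  "inner_product (edges G) (edge_coboundary q) x = inner_product \<Delta> q (dart_lift x)"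
proof -
  have "inner_product (edges G) (edge_coboundary q) x
      = (\<Sum>e\<in>edges G. \<Sum>d | d \<in> M \<and> {d, \<alpha> d} = e. q d * x {d, \<alpha> d})"
    unfolding inner_product_def
  proof (rule sum.cong[OF refl])
    fix e assume e: "e \<in> edges G"
    then have "{d. d \<in> M \<and> {d, \<alpha> d} = e} = e"
      unfolding edges_G by (auto simp: doubleton_eq_iff)
    moreover have "(\<Sum>d | d \<in> M \<and> {d, \<alpha> d} = e. q d * x {d, \<alpha> d})
        = (\<Sum>d | d \<in> M \<and> {d, \<alpha> d} = e. q d * x e)"
      by (rule sum.cong) auto
    ultimately show "edge_coboundary q e * x e
        = (\<Sum>d | d \<in> M \<and> {d, \<alpha> d} = e. q d * x {d, \<alpha> d})"
      using e by (simp add: edge_coboundary_def sum_distrib_right)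
  qed
  also have "\<dots> = (\<Sum>d\<in>M. q d * x {d, \<alpha> d})"
    by (rule sum.group) (use finite_marked finite_edges_G edges_G in auto)
  also have "\<dots> = (\<Sum>d\<in>\<Delta>. q d * dart_lift x d)"
    by (rule sum.mono_neutral_cong_left) (use finite_darts in \<open>auto simp: dart_lift_def marked_iff\<close>)
  finally show ?thesis by (simp add: inner_product_def)
qed

lemma dart_lift_Inv_opp: "dart_lift x \<in> Inv \<alpha>"
  by (auto simp: invariant_vecs_def vecs_def dart_lift_def marked_iff insert_commute)

text \<open>Between its two marked points an arc passes only alternating edges, across which
  \<open>P\<close> does not change by \<open>alt\<close>; turning at a crossing does not change it
  either.\<close>

lemma constant_along_arc:
  assumes P: "P \<in> Inv \<rho>" and alt: "\<And>d. d \<in> \<Delta> - M \<Longrightarrow> P d = P (\<alpha> d)" and "arc D d e"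
  shows "P d = P e"
proof -
  obtain n where e: "e = (face_step D ^^ n) (\<rho> d)"
    and n: "\<forall>i<n. \<not> nonalternating D ((face_step D ^^ i) (\<rho> d))" and d: "d \<in> M"
    using assms(3) unfolding arc_def by blast
  have in_darts: "(face_step D ^^ i) (\<rho> d) \<in> \<Delta>" for i
    using d by (induction i) (simp_all add: marked_iff face_step_def)
  have "P ((face_step D ^^ i) (\<rho> d)) = P d" if "i \<le> n" for i
    using that
  proof (induction i)
    case 0
    then show ?case using invariant_vecs_apply[OF rot_permutes P] by simp
  next
    case (Suc i)
    let ?c = "(face_step D ^^ i) (\<rho> d)"
    have "?c \<in> \<Delta> - M" using in_darts n Suc.prems by (simp add: marked_iff)
    from alt[OF this] have "P (\<alpha> ?c) = P ?c" ..
    moreover have "P (face_step D ?c) = P (\<alpha> ?c)"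
      using invariant_vecs_apply[OF rot_permutes P] by (simp add: face_step_def)
    ultimately show ?case using Suc by simp
  qed
  then show ?thesis using e by simp
qed

text \<open>Walking around a face, a function that is constant on curves takes the same value at the two
  ends of each arc, so its coboundary sums to zero over the face.\<close>

lemma dart_lift_cut:
  assumes p: "\<And>d. d \<in> M \<Longrightarrow> x {d, \<alpha> d} = p (curve_of d) + p (curve_of (\<alpha> d))"
  shows "dart_lift x \<in> perp \<Delta> (Inv \<phi>)"
proof -
  let ?f = "face_step D"
  define hit where "hit d n \<longleftrightarrow> (?f ^^ n) d \<in> M" for d n
  \<comment> \<open>This is the potential of the curve through the first marked point met from d
    onward, d itself included. The default 0 is taken only on faces without marked points, hence on
    whole orbits of \<open>?f\<close>.\<close>
  define next_value where
    "next_value d = (if \<exists>n. hit d n then p (curve_of ((?f ^^ (LEAST n. hit d n)) d)) else 0)" for d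
  have hit_Suc: "hit d (Suc n) \<longleftrightarrow> hit (?f d) n" for d n
    unfolding hit_def by (simp add: funpow_swap1)
  have unmarked: "next_value d = next_value (?f d)" if "d \<notin> M" for d
  proof -
    have "\<not> hit d 0" using that by (simp add: hit_def)
    then have ex: "(\<exists>n. hit d n) \<longleftrightarrow> (\<exists>n. hit (?f d) n)" by (metis hit_Suc not0_implies_Suc)
    have "(LEAST n. hit d n) = Suc (LEAST n. hit (?f d) n)" if "hit d n" for n
      using Least_Suc[of "hit d" n, OF that \<open>\<not> hit d 0\<close>] by (simp add: hit_Suc)
    then show ?thesis unfolding next_value_def ex by (auto simp: funpow_swap1 simp flip: ex)
  qed
  have marked: "next_value d = p (curve_of d)" if "d \<in> M" for d
  proof -
    have "hit d 0" using that by (simp add: hit_def)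
    then show ?thesis unfolding next_value_def by (auto intro!: Least_eq_0)
  qed
  \<comment> \<open>The walk from \<open>?f d\<close> returns to the marked point d, so it does hit
    one. Since \<open>?f d\<close> is \<open>rot\<close> applied to \<open>\<alpha> d\<close>, its
    first hit is the end of the arc starting at \<open>\<alpha> d\<close>.\<close>
  have marked_next: "next_value (?f d) = p (curve_of (\<alpha> d))" if d: "d \<in> M" for d
  proof -
    have "d \<in> orbit ?f d" using permutes_self_in_orbit[OF face_step_permutes finite_darts] .
    then obtain m where m: "d = (?f ^^ m) d" "0 < m" unfolding orbit_altdef by blast
    have "hit d m" unfolding hit_def using d m(1) by metis
    then have "hit (?f d) (m - 1)" using m(2) hit_Suc[of d "m - 1"] by simp
    then have ex: "\<exists>n. hit (?f d) n" by blast
    define n where "n = (LEAST n. hit (?f d) n)"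
    have "hit (?f d) n" unfolding n_def using ex by (rule LeastI_ex)
    moreover have "\<not> hit (?f d) i" if "i < n" for i
      using that unfolding n_def by (rule not_less_Least)
    moreover have in_darts: "(?f ^^ i) (?f d) \<in> \<Delta>" for i
      using d by (induction i) (simp_all add: marked_iff face_step_def)
    ultimately have "arc D (\<alpha> d) ((?f ^^ n) (?f d))"
      unfolding arc_def hit_def
      using d by (auto simp: face_step_def marked_iff intro!: exI[of _ n])
    then show ?thesis using curve_of_arc ex by (simp add: next_value_def n_def)
  qed
  have coboundary: "dart_lift x = next_value + (next_value \<circ> ?f)"
  proof
    fix d
    show "dart_lift x d = (next_value + (next_value \<circ> ?f)) d"
      using p[of d] marked[of d] marked_next[of d] unmarked[of d]
      by (cases "d \<in> M") (simp_all add: dart_lift_def)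
  qed
  have "inner_product \<Delta> q (dart_lift x) = 0" if q: "q \<in> Inv \<phi>" for q
  proof -
    \<comment> \<open>q is invariant under \<open>corner_step\<close> while the walk uses
      \<open>face_step\<close>; composing with \<open>\<alpha>\<close> changes one into the other
      and leaves \<open>dart_lift x\<close> fixed. The coboundary then cancels after permuting by
      \<open>?f\<close>.\<close>
    have "q (\<alpha> (?f d)) = q (\<alpha> d)" for d
      using invariant_vecs_apply[OF corner_step_permutes q, of "\<alpha> d"]
      by (simp add: corner_step_def face_step_def)
    then have qf: "(q \<circ> \<alpha>) \<circ> ?f = q \<circ> \<alpha>" by auto
    have "dart_lift x \<circ> \<alpha> = dart_lift x"
      using invariant_vecs_apply[OF opp_permutes dart_lift_Inv_opp] by auto
    then have "inner_product \<Delta> q (dart_lift x) = inner_product \<Delta> (q \<circ> \<alpha>) (dart_lift x)"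
      using inner_product_comp_permutes[OF opp_permutes, of q "dart_lift x"] by metis
    also have "\<dots> = inner_product \<Delta> (q \<circ> \<alpha>) next_value
        + inner_product \<Delta> ((q \<circ> \<alpha>) \<circ> ?f) (next_value \<circ> ?f)"
      unfolding coboundary qf by (rule inner_product_add_right)
    also have "\<dots> = 0"
      unfolding inner_product_comp_permutes[OF face_step_permutes] by simp
    finally show ?thesis .
  qed
  then show ?thesis
    using subsetD[OF invariant_vecs_subset dart_lift_Inv_opp] by (simp add: perp_def)
qed

text \<open>\<open>P\<close> is constant along arcs, hence on the marked points of a curve, so it
  induces a potential on the curves whose cut is \<open>x\<close>.\<close>

lemma coboundary_in_cut_space:
  assumes x: "x \<in> vecs (edges G)" and P: "P \<in> Inv \<rho>"
    and M: "\<And>d. d \<in> M \<Longrightarrow> x {d, \<alpha> d} = P d + P (\<alpha> d)"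
    and alt: "\<And>d. d \<in> \<Delta> - M \<Longrightarrow> P d = P (\<alpha> d)"
  shows "x \<in> cut_space G"
proof -
  define p where "p \<gamma> = P (SOME d. d \<in> \<gamma>)" for \<gamma>
  have p: "p (curve_of d) = P d" if d: "d \<in> M" for d
  proof -
    have const: "P a = P b" if "a \<in> curve_of d" "b \<in> curve_of d" for a b
    proof -
      obtain u where "curve_of d = {y \<in> M. equivclp (\<lambda>a b. a \<in> M \<and> b \<in> M \<and> arc D a b) u y}"
        using curve_of(1)[OF d] unfolding curves_def classes_of_def by blast
      then have "P u = P c" if "c \<in> curve_of d" for c
        using that constant_on_class[of M "arc D" u c P] constant_along_arc[OF P alt] by simp
      then show ?thesis using that by metis
    qed
    have "(SOME a. a \<in> curve_of d) \<in> curve_of d" using curve_of(2)[OF d] by (rule someI)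
    then show ?thesis unfolding p_def using const curve_of(2)[OF d] by blast
  qed
  have "x e = p u + p v" if e: "e \<in> edges G" "ends G e = {u, v}" for e u v
  proof -
    obtain d where d: "d \<in> M" "e = {d, \<alpha> d}" using e unfolding edges_G by blast
    then have "{u, v} = {curve_of d, curve_of (\<alpha> d)}" using ends_G e by simp
    moreover have "x e = p (curve_of d) + p (curve_of (\<alpha> d))" using d M p by simp
    ultimately show ?thesis by (auto simp: doubleton_eq_iff add.commute)
  qed
  then show ?thesis using x unfolding cut_space_def by blast
qed

lemma dart_lift_cocycle:
  assumes "dart_lift x \<in> perp \<Delta> (Inv \<phi>)"
  obtains P where "P \<in> Inv \<rho>" "\<And>d. d \<in> M \<Longrightarrow> x {d, \<alpha> d} = P d + P (\<alpha> d)"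
    "\<And>d. d \<in> \<Delta> - M \<Longrightarrow> P d = P (\<alpha> d)"
proof -
  have "dart_lift x \<in> {y + (y \<circ> \<alpha>) |y. y \<in> Inv \<rho>}"
    using assms dart_lift_Inv_opp cocycle_space by blast
  then obtain P where P: "P \<in> Inv \<rho>" "dart_lift x = P + (P \<circ> \<alpha>)" by blast
  then have *: "dart_lift x d = P d + P (\<alpha> d)" for d by simp
  show thesis
  proof (rule that[OF P(1)])
    fix d assume "d \<in> M"
    then show "x {d, \<alpha> d} = P d + P (\<alpha> d)" using *[of d] by (simp add: dart_lift_def)
  next
    fix d assume "d \<in> \<Delta> - M"
    then show "P d = P (\<alpha> d)" using *[of d] bit_add_eq_0_iff by (simp add: dart_lift_def)
  qed
qed

text \<open>Sphericity enters in the converse: through \<open>cocycle_space\<close> a cocycle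
  supported on non-alternating edges gets a potential on crossings, which descends to the
  curves.\<close>

lemma cut_space_iff_cocycle:
  assumes "x \<in> vecs (edges G)"
  shows "x \<in> cut_space G \<longleftrightarrow> dart_lift x \<in> perp \<Delta> (Inv \<phi>)"
proof
  assume "x \<in> cut_space G"
  then obtain p where p: "\<forall>e\<in>edges G. \<forall>u v. ends G e = {u, v} \<longrightarrow> x e = p u + p v"
    unfolding cut_space_def by auto
  have "x {d, \<alpha> d} = p (curve_of d) + p (curve_of (\<alpha> d))" if "d \<in> M" for d
  proof -
    have "{d, \<alpha> d} \<in> edges G" using that by (auto simp: edges_G)
    then show ?thesis using p ends_G[OF that] by blast
  qed
  then show "dart_lift x \<in> perp \<Delta> (Inv \<phi>)" by (rule dart_lift_cut)
next
  assume a: "dart_lift x \<in> perp \<Delta> (Inv \<phi>)"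
  show "x \<in> cut_space G"
  proof (rule dart_lift_cocycle[OF a])
    fix P
    assume "P \<in> Inv \<rho>" "\<And>d. d \<in> M \<Longrightarrow> x {d, \<alpha> d} = P d + P (\<alpha> d)"
      "\<And>d. d \<in> \<Delta> - M \<Longrightarrow> P d = P (\<alpha> d)"
    then show ?thesis by (rule coboundary_in_cut_space[OF assms])
  qed
qed

text \<open>By adjointness the cocycle condition says that cuts are the vectors orthogonal to the
  coboundaries of face functions; taking complements once more gives the claim.\<close>

lemma perp_cut_space: "perp (edges G) (cut_space G) = edge_coboundary ` Inv \<phi>"
proof -
  let ?Q = "edge_coboundary ` Inv \<phi>"
  have vecs_Q: "?Q \<subseteq> vecs (edges G)" using edge_coboundary_in_vecs by blast
  have "0 \<in> ?Q"
    using additive_subgroup_zero[OF additive_subgroup_invariant_vecs, of \<Delta> \<phi>]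
    by (auto simp: image_iff edge_coboundary_def fun_eq_iff intro!: bexI[of _ 0])
  moreover have "x - y \<in> ?Q" if "x \<in> ?Q" "y \<in> ?Q" for x y
    using that additive_subgroup_diff[OF additive_subgroup_invariant_vecs, of _ \<Delta> \<phi>]
    by (auto simp flip: edge_coboundary_diff)
  ultimately have sub: "additive_subgroup ?Q" by (simp add: additive_subgroup_def)
  have "cut_space G = perp (edges G) ?Q"
  proof (intro equalityI subsetI)
    fix x assume x: "x \<in> cut_space G"
    then have "dart_lift x \<in> perp \<Delta> (Inv \<phi>)"
      using cut_space_iff_cocycle cut_space_subset by blast
    then show "x \<in> perp (edges G) ?Q"
      using x cut_space_subset by (auto simp: perp_def inner_product_edge_coboundary)
  next
    fix x assume x: "x \<in> perp (edges G) ?Q"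
    then have v: "x \<in> vecs (edges G)" by (simp add: perp_def)
    have "dart_lift x \<in> perp \<Delta> (Inv \<phi>)"
      using x subsetD[OF invariant_vecs_subset dart_lift_Inv_opp]
      by (auto simp: perp_def inner_product_edge_coboundary)
    then show "x \<in> cut_space G" using cut_space_iff_cocycle[OF v] by simp
  qed
  then show ?thesis using perp_perp[OF finite_edges_G sub vecs_Q] by simp
qed

section \<open>Counting state circles\<close>

text \<open>Each corner lies on exactly one state circle: the A-circle through it if its dart is under,
  the B-circle if it is over. These are the functions on corners that are constant along state
  circles.\<close>

definition state_functions :: "('d \<Rightarrow> bit) set" where
  "state_functions = {h \<in> vecs \<Delta>. \<forall>d\<in>\<Delta>.
     if nonalternating D d then h (\<alpha> d) = h d \<and> h (inv \<rho> (\<alpha> d)) = h (inv \<rho> d)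
     else h (\<alpha> d) = h (inv \<rho> d)}"

lemma state_functions_nonalternating:
  "h \<in> state_functions \<Longrightarrow> d \<in> \<Delta> \<Longrightarrow> nonalternating D d \<Longrightarrow>
    h (\<alpha> d) = h d \<and> h (inv \<rho> (\<alpha> d)) = h (inv \<rho> d)"
  and state_functions_alternating:
  "h \<in> state_functions \<Longrightarrow> d \<in> \<Delta> \<Longrightarrow> \<not> nonalternating D d \<Longrightarrow> h (\<alpha> d) = h (inv \<rho> d)"
  by (auto simp: state_functions_def)

text \<open>A dart d borders its own corner and the corner \<open>inv \<rho> d\<close>; one of these
  carries the A-circle through d and the other the B-circle, depending on whether d is over.
  \<open>F\<close> merges a pair of functions on the two states into one on corners, and
  \<open>F'\<close> recovers the pair at each dart from its two corners.\<close>

lemma card_state_functions: "card state_functions = 2 ^ (card (A_state D) + card (B_state D))"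
proof -
  define A where "A = respecting \<Delta> (\<lambda>d e. e = \<alpha> d \<or> (\<not> over D d \<and> e = \<rho> d))"
  define B where "B = respecting \<Delta> (\<lambda>d e. e = \<alpha> d \<or> (over D d \<and> e = \<rho> d))"
  define F where "F p = (\<lambda>d. if over D d then snd p d else fst p d)"
    for p :: "('d \<Rightarrow> bit) \<times> ('d \<Rightarrow> bit)"
  define F' where "F' h = (\<lambda>d. if over D d then h (inv \<rho> d) else h d,
      \<lambda>d. if over D d then h d else h (inv \<rho> d))" for h :: "'d \<Rightarrow> bit"
  have A_iff: "x \<in> A \<longleftrightarrow> x \<in> vecs \<Delta> \<and>
      (\<forall>d\<in>\<Delta>. x (\<alpha> d) = x d \<and> (over D d \<longrightarrow> x (inv \<rho> d) = x d))" for x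
  proof
    assume x: "x \<in> A"
    have "x (\<alpha> d) = x d" "over D d \<longrightarrow> x (inv \<rho> d) = x d" if d: "d \<in> \<Delta>" for d
    proof -
      have e: "x a = x b" if "a \<in> \<Delta>" "b \<in> \<Delta>" "b = \<alpha> a \<or> (\<not> over D a \<and> b = \<rho> a)" for a b
        using x that unfolding A_def respecting_def by blast
      show "x (\<alpha> d) = x d" using e[of "\<alpha> d" d] d by simp
      show "over D d \<longrightarrow> x (inv \<rho> d) = x d"
        using e[of "inv \<rho> d" d] d over_inv_rot[OF d] by simp
    qed
    then show "x \<in> vecs \<Delta> \<and> (\<forall>d\<in>\<Delta>. x (\<alpha> d) = x d \<and> (over D d \<longrightarrow> x (inv \<rho> d) = x d))"
      using x unfolding A_def respecting_def by blast
  next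
    assume x: "x \<in> vecs \<Delta> \<and> (\<forall>d\<in>\<Delta>. x (\<alpha> d) = x d \<and> (over D d \<longrightarrow> x (inv \<rho> d) = x d))"
    have "x d = x e" if "d \<in> \<Delta>" "e \<in> \<Delta>" "e = \<alpha> d \<or> (\<not> over D d \<and> e = \<rho> d)" for d e
      using x that over_rot[of d] bspec[of \<Delta> _ "\<rho> d"] by (metis rot_inv_rot(2))
    then show "x \<in> A" using x unfolding A_def respecting_def by blast
  qed
  have B_iff: "x \<in> B \<longleftrightarrow> x \<in> vecs \<Delta> \<and>
      (\<forall>d\<in>\<Delta>. x (\<alpha> d) = x d \<and> (\<not> over D d \<longrightarrow> x (inv \<rho> d) = x d))" for x
  proof
    assume x: "x \<in> B"
    have "x (\<alpha> d) = x d" "\<not> over D d \<longrightarrow> x (inv \<rho> d) = x d" if d: "d \<in> \<Delta>" for d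
    proof -
      have e: "x a = x b" if "a \<in> \<Delta>" "b \<in> \<Delta>" "b = \<alpha> a \<or> (over D a \<and> b = \<rho> a)" for a b
        using x that unfolding B_def respecting_def by blast
      show "x (\<alpha> d) = x d" using e[of "\<alpha> d" d] d by simp
      show "\<not> over D d \<longrightarrow> x (inv \<rho> d) = x d"
        using e[of "inv \<rho> d" d] d over_inv_rot[OF d] by simp
    qed
    then show "x \<in> vecs \<Delta> \<and> (\<forall>d\<in>\<Delta>. x (\<alpha> d) = x d \<and> (\<not> over D d \<longrightarrow> x (inv \<rho> d) = x d))"
      using x unfolding B_def respecting_def by blast
  next
    assume x: "x \<in> vecs \<Delta> \<and> (\<forall>d\<in>\<Delta>. x (\<alpha> d) = x d \<and> (\<not> over D d \<longrightarrow> x (inv \<rho> d) = x d))"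
    have "x d = x e" if "d \<in> \<Delta>" "e \<in> \<Delta>" "e = \<alpha> d \<or> (over D d \<and> e = \<rho> d)" for d e
      using x that over_rot[of d] bspec[of \<Delta> _ "\<rho> d"] by (metis rot_inv_rot(2))
    then show "x \<in> B" using x unfolding B_def respecting_def by blast
  qed
  have over_opp: "over D (\<alpha> d) \<longleftrightarrow> (if nonalternating D d then over D d else \<not> over D d)" for d
    by (auto simp: nonalternating_def)
  have "bij_betw F (A \<times> B) state_functions"
  proof (rule bij_betw_byWitness[where f' = F'])
    show "\<forall>p\<in>A \<times> B. F' (F p) = p"
    proof
      fix p assume "p \<in> A \<times> B"
      then obtain x y where p: "p = (x, y)" "x \<in> A" "y \<in> B" by blast
      have "fst (F' (F p)) d = x d \<and> snd (F' (F p)) d = y d" for d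
      proof (cases "d \<in> \<Delta>")
        case True
        have "over D d \<Longrightarrow> x (inv \<rho> d) = x d" "\<not> over D d \<Longrightarrow> y (inv \<rho> d) = y d"
          using p True A_iff B_iff by blast+
        then show ?thesis using p(1) over_inv_rot[OF True] by (simp add: F_def F'_def)
      next
        case False
        then have "inv \<rho> d = d" "x d = 0" "y d = 0"
          using permutes_not_in[OF inv_rot_permutes] p A_iff B_iff unfolding vecs_def by blast+
        then show ?thesis using p(1) by (simp add: F_def F'_def)
      qed
      then show "F' (F p) = p" unfolding p(1) by (simp add: prod_eq_iff fun_eq_iff)
    qed
    show "\<forall>h\<in>state_functions. F (F' h) = h"
      by (auto simp: F_def F'_def)
    show "F ` (A \<times> B) \<subseteq> state_functions"
    proof
      fix h assume "h \<in> F ` (A \<times> B)"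
      then obtain x y where x: "x \<in> A" and y: "y \<in> B" and h: "h = F (x, y)" by blast
      have "if nonalternating D d then h (\<alpha> d) = h d \<and> h (inv \<rho> (\<alpha> d)) = h (inv \<rho> d)
          else h (\<alpha> d) = h (inv \<rho> d)" if d: "d \<in> \<Delta>" for d
        using x y d over_inv_rot[of d] over_inv_rot[of "\<alpha> d"] over_opp[of d]
        by (simp add: h F_def A_iff B_iff)
      moreover have "h \<in> vecs \<Delta>" using x y by (auto simp: h F_def A_iff B_iff vecs_def)
      ultimately show "h \<in> state_functions" by (simp add: state_functions_def)
    qed
    show "F' ` state_functions \<subseteq> A \<times> B"
    proof (rule image_subsetI)
      fix h assume h: "h \<in> state_functions"
      have opp: "h (inv \<rho> (\<alpha> d)) = h d" if "d \<in> \<Delta>" "\<not> nonalternating D d" for d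
        using state_functions_alternating[OF h, of "\<alpha> d"] that by simp
      have v: "h d = 0" if "d \<notin> \<Delta>" for d using h that by (simp add: state_functions_def vecs_def)
      have "fst (F' h) \<in> A"
        using v state_functions_nonalternating[OF h] state_functions_alternating[OF h] opp
        by (simp add: F'_def A_iff vecs_def over_opp over_inv_rot)
      moreover have "snd (F' h) \<in> B"
        using v state_functions_nonalternating[OF h] state_functions_alternating[OF h] opp
        by (simp add: F'_def B_iff vecs_def over_opp over_inv_rot)
      ultimately show "F' h \<in> A \<times> B" by (simp add: mem_Times_iff)
    qed
  qed
  then have "card state_functions = card A * card B"
    by (metis bij_betw_same_card card_cartesian_product)
  then show ?thesis
    unfolding A_def B_def card_respecting[OF finite_darts] A_state_def B_state_def
    by (simp add: power_add)
qed

lemma additive_subgroup_state_functions: "additive_subgroup state_functions"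
proof -
  have "0 \<in> state_functions" by (simp add: state_functions_def vecs_def)
  moreover have "x + y \<in> state_functions" if "x \<in> state_functions" "y \<in> state_functions" for x y
    using that additive_subgroup_add[OF additive_subgroup_vecs, of x \<Delta> y]
    by (simp add: state_functions_def)
  ultimately show ?thesis by (simp add: additive_subgroup_bit_iff)
qed

text \<open>The corners \<open>inv \<rho> d\<close> and d share a crossing, and
  \<open>inv \<rho> d\<close> and \<open>\<alpha> d\<close> share a face. After these substitutions
  both conditions at a non-alternating edge say that p and q have the same coboundary, and at an
  alternating edge q cancels.\<close>

lemma sum_in_state_functions_iff:
  assumes p: "p \<in> Inv \<rho>" and q: "q \<in> Inv \<phi>"
  shows "p + q \<in> state_functions \<longleftrightarrow>
    (\<forall>d\<in>M. p d + p (\<alpha> d) = q d + q (\<alpha> d)) \<and> (\<forall>d\<in>\<Delta> - M. p d = p (\<alpha> d))"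
proof -
  have p': "p (inv \<rho> d) = p d" for d
    using invariant_vecs_apply[OF rot_permutes p, of "inv \<rho> d"] by simp
  have q': "q (inv \<rho> d) = q (\<alpha> d)" for d
    using invariant_vecs_apply[OF corner_step_permutes q, of "inv \<rho> d"] by (simp add: corner_step_def)
  let ?h = "p + q"
  have pointwise: "(if nonalternating D d then ?h (\<alpha> d) = ?h d \<and> ?h (inv \<rho> (\<alpha> d)) = ?h (inv \<rho> d)
      else ?h (\<alpha> d) = ?h (inv \<rho> d)) \<longleftrightarrow>
    (if nonalternating D d then p d + p (\<alpha> d) = q d + q (\<alpha> d) else p d = p (\<alpha> d))" for d
    unfolding plus_fun_apply p' q' opp_opp
    by (cases "p d"; cases "p (\<alpha> d)"; cases "q d"; cases "q (\<alpha> d)"; simp)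
  have split: "(\<forall>d\<in>\<Delta>. if nonalternating D d then A d else B d) \<longleftrightarrow>
      (\<forall>d\<in>M. A d) \<and> (\<forall>d\<in>\<Delta> - M. B d)" for A B
    by (simp only: marked_iff Ball_def Diff_iff if_bool_eq_conj) blast
  have "?h \<in> vecs \<Delta>"
    using p q invariant_vecs_subset by (intro additive_subgroup_add[OF additive_subgroup_vecs]) blast+
  then have "?h \<in> state_functions \<longleftrightarrow> (\<forall>d\<in>\<Delta>. if nonalternating D d
      then ?h (\<alpha> d) = ?h d \<and> ?h (inv \<rho> (\<alpha> d)) = ?h (inv \<rho> d) else ?h (\<alpha> d) = ?h (inv \<rho> d))"
    unfolding state_functions_def by blast
  then show ?thesis unfolding pointwise split .
qed

text \<open>At either kind of edge the state conditions make \<open>h d + h (inv \<rho> d)\<close>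
  the same at both darts, which is the hypothesis for splitting corner functions.\<close>

lemma state_functions_decomposition:
  assumes "h \<in> state_functions"
  obtains p q where "p \<in> Inv \<rho>" "q \<in> Inv \<phi>" "h = p + q"
proof -
  have h: "h \<in> vecs \<Delta>" using assms by (simp add: state_functions_def)
  have "h (\<alpha> d) + h (inv \<rho> (\<alpha> d)) = h d + h (inv \<rho> d)" if d: "d \<in> \<Delta>" for d
  proof (cases "nonalternating D d")
    case False
    then show ?thesis
      using state_functions_alternating[OF assms d] state_functions_alternating[OF assms, of "\<alpha> d"] d
      by (simp add: add.commute)
  qed (use state_functions_nonalternating[OF assms d] in simp)
  then have "h + (h \<circ> inv \<rho>) \<in> Inv \<alpha>"
    using h vecs_comp_permutes[OF inv_rot_permutes h]
      additive_subgroup_add[OF additive_subgroup_vecs, of h \<Delta> "h \<circ> inv \<rho>"]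
    by (simp add: invariant_vecs_def)
  then show thesis using corner_function_decomposition[OF h] that by blast
qed

lemma card_state_functions_cut_space:
  "card state_functions * 2 ^ card (edges G)
    = card (cut_space G) * card (bicycle_space G) * 2 ^ card (orbit (face_step D) ` \<Delta>)"
proof -
  note inv_sub = additive_subgroup_invariant_vecs
  define k where "k = card (crossing_components D)"
  define W where "W = {pq \<in> Inv \<rho> \<times> Inv \<phi>. fst pq + snd pq \<in> state_functions}"
  define ker where "ker = {q \<in> Inv \<phi>. edge_coboundary q = 0}"
  let ?C = "cut_space G"
  have finW: "finite W" unfolding W_def using finite_Inv by simp
  have subW: "additive_subgroup W"
    unfolding additive_subgroup_def
  proof (intro conjI ballI)
    show "0 \<in> W"
      using additive_subgroup_zero[OF inv_sub[of \<Delta> \<rho>]] additive_subgroup_zero[OF inv_sub[of \<Delta> \<phi>]]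
        additive_subgroup_zero[OF additive_subgroup_state_functions]
      by (simp add: W_def mem_Times_iff)
    fix x y assume xy: "x \<in> W" "y \<in> W"
    have eq: "(fst x - fst y) + (snd x - snd y) = (fst x + snd x) - (fst y + snd y)"
      by (simp add: algebra_simps)
    have "(fst x - fst y) + (snd x - snd y) \<in> state_functions"
      unfolding eq using xy additive_subgroup_diff[OF additive_subgroup_state_functions]
      unfolding W_def by blast
    then show "x - y \<in> W"
      using xy additive_subgroup_diff[OF inv_sub[of \<Delta> \<rho>]] additive_subgroup_diff[OF inv_sub[of \<Delta> \<phi>]]
      unfolding W_def by (simp add: mem_Times_iff)
  qed
  \<comment> \<open>First count of \<open>W\<close>, by the sum. The kernel is the diagonal of
    functions constant both on crossings and on faces, that is, on components.\<close>
  have "card W = card ((\<lambda>pq. fst pq + snd pq) ` W) * card {pq \<in> W. fst pq + snd pq = 0}"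
    by (rule card_eq_card_image_times_kernel[OF finW subW]) (simp add: algebra_simps)
  moreover have "(\<lambda>pq. fst pq + snd pq) ` W = state_functions"
  proof (intro equalityI subsetI)
    fix h assume h: "h \<in> state_functions"
    then obtain p q where "p \<in> Inv \<rho>" "q \<in> Inv \<phi>" "h = p + q"
      by (rule state_functions_decomposition)
    then have "(p, q) \<in> W" "h = fst (p, q) + snd (p, q)" using h by (simp_all add: W_def)
    then show "h \<in> (\<lambda>pq. fst pq + snd pq) ` W" by blast
  qed (auto simp: W_def)
  moreover have "{pq \<in> W. fst pq + snd pq = 0} = (\<lambda>p. (p, p)) ` (Inv \<alpha> \<inter> Inv \<rho>)"
  proof -
    have "p + q = 0 \<longleftrightarrow> p = q" for p q :: "'d \<Rightarrow> bit"
      by (simp add: fun_eq_iff bit_add_eq_0_iff)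
    moreover have "Inv \<alpha> \<inter> Inv \<rho> = {p \<in> Inv \<rho>. p \<in> Inv \<phi>}"
      using Inv_corner_step_Int(2) by blast
    ultimately show ?thesis
      using additive_subgroup_zero[OF additive_subgroup_state_functions]
      unfolding W_def by auto
  qed
  moreover have "card ((\<lambda>p. (p, p)) ` (Inv \<alpha> \<inter> Inv \<rho>)) = 2 ^ k"
    using card_Inv_opp_Int_Inv_rot by (subst card_image) (auto simp: inj_on_def k_def)
  ultimately have W1: "card W = card state_functions * 2 ^ k" by simp
  have "card W = card ((\<lambda>pq. edge_coboundary (snd pq)) ` W) * card {pq \<in> W. edge_coboundary (snd pq) = 0}"
    by (rule card_eq_card_image_times_kernel[OF finW subW]) (simp add: edge_coboundary_diff)
  \<comment> \<open>Second count of \<open>W\<close>, by the common coboundary: coming from p makes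
    it a cut, coming from q makes it orthogonal to all cuts.\<close>
  moreover have "(\<lambda>pq. edge_coboundary (snd pq)) ` W = bicycle_space G"
  proof (intro equalityI subsetI)
    fix x assume "x \<in> (\<lambda>pq. edge_coboundary (snd pq)) ` W"
    then obtain p q where pq: "p \<in> Inv \<rho>" "q \<in> Inv \<phi>" "p + q \<in> state_functions"
      and x: "x = edge_coboundary q" unfolding W_def by auto
    have cob: "\<forall>d\<in>M. p d + p (\<alpha> d) = q d + q (\<alpha> d)" "\<forall>d\<in>\<Delta> - M. p d = p (\<alpha> d)"
      using pq(3) unfolding sum_in_state_functions_iff[OF pq(1,2)] by blast+
    have "x {d, \<alpha> d} = p d + p (\<alpha> d)" if "d \<in> M" for d
      using edge_coboundary_apply[OF that, of q] bspec[OF cob(1) that] x by simp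
    then have "x \<in> ?C"
      using coboundary_in_cut_space[OF _ pq(1), of x] cob(2) x edge_coboundary_in_vecs by blast
    then show "x \<in> bicycle_space G"
      using x pq(2) by (simp add: bicycle_space_def perp_cut_space)
  next
    fix x assume x: "x \<in> bicycle_space G"
    then obtain q where q: "q \<in> Inv \<phi>" "x = edge_coboundary q"
      unfolding bicycle_space_def perp_cut_space by blast
    have "dart_lift x \<in> perp \<Delta> (Inv \<phi>)"
      using x cut_space_iff_cocycle cut_space_subset unfolding bicycle_space_def by blast
    then obtain P where P: "P \<in> Inv \<rho>" "\<forall>d\<in>M. x {d, \<alpha> d} = P d + P (\<alpha> d)"
      "\<forall>d\<in>\<Delta> - M. P d = P (\<alpha> d)"
      using dart_lift_cocycle by metis
    have "P d + P (\<alpha> d) = q d + q (\<alpha> d)" if "d \<in> M" for d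
      using bspec[OF P(2) that] edge_coboundary_apply[OF that, of q] q(2) by simp
    then have "P + q \<in> state_functions"
      unfolding sum_in_state_functions_iff[OF P(1) q(1)] using P(3) by blast
    then have "(P, q) \<in> W" using P q by (simp add: W_def)
    then show "x \<in> (\<lambda>pq. edge_coboundary (snd pq)) ` W" using q(2) by (force simp: image_iff)
  qed
  \<comment> \<open>Once the coboundary of q vanishes on the non-alternating edges, the condition on
    p is equality across every edge, independently of q; hence a product.\<close>
  moreover have "{pq \<in> W. edge_coboundary (snd pq) = 0} = (Inv \<alpha> \<inter> Inv \<rho>) \<times> ker"
  proof -
    have "p + q \<in> state_functions \<longleftrightarrow> p \<in> Inv \<alpha>"
      if pq: "p \<in> Inv \<rho>" "q \<in> Inv \<phi>" "edge_coboundary q = 0" for p q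
    proof -
      have M: "p d + p (\<alpha> d) = q d + q (\<alpha> d) \<longleftrightarrow> p (\<alpha> d) = p d" if "d \<in> M" for d
      proof -
        have "q d + q (\<alpha> d) = 0" using edge_coboundary_apply[OF that, of q] pq(3) by simp
        then show ?thesis by (cases "p d"; cases "p (\<alpha> d)"; simp)
      qed
      have "p + q \<in> state_functions \<longleftrightarrow> (\<forall>d\<in>M. p (\<alpha> d) = p d) \<and> (\<forall>d\<in>\<Delta> - M. p d = p (\<alpha> d))"
        unfolding sum_in_state_functions_iff[OF pq(1,2)] using M by blast
      also have "\<dots> \<longleftrightarrow> (\<forall>d\<in>\<Delta>. p (\<alpha> d) = p d)"
        unfolding marked_iff Ball_def Diff_iff by metis
      also have "\<dots> \<longleftrightarrow> p \<in> Inv \<alpha>"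
        using subsetD[OF invariant_vecs_subset pq(1)] unfolding invariant_vecs_def by blast
      finally show ?thesis .
    qed
    then show ?thesis unfolding W_def ker_def by (auto simp: mem_Times_iff)
  qed
  ultimately have W2: "card W = card (bicycle_space G) * (2 ^ k * card ker)"
    using card_Inv_opp_Int_Inv_rot by (simp add: card_cartesian_product k_def)
  have H: "card state_functions = card (bicycle_space G) * card ker"
    using W1 W2 by simp
  \<comment> \<open>Rank-nullity for the coboundary of face functions eliminates \<open>ker\<close>,
    its image being the complement of the cut space.\<close>
  have F: "2 ^ card (orbit (face_step D) ` \<Delta>) = card (perp (edges G) ?C) * card ker"
    using card_eq_card_image_times_kernel[OF finite_Inv inv_sub, of \<phi> edge_coboundary]
      edge_coboundary_diff card_invariant_vecs[OF corner_step_permutes finite_darts]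
    by (simp add: perp_cut_space ker_def card_orbits_corner_step)
  have E: "card ?C * card (perp (edges G) ?C) = 2 ^ card (edges G)"
    by (rule card_times_card_perp[OF finite_edges_G additive_subgroup_cut_space cut_space_subset])
  show ?thesis unfolding F H E[symmetric] by (simp only: ac_simps)
qed

section \<open>The genus formula and its consequence\<close>

lemma bicycle_weight_G: "bicycle_weight G = 2 powr (2 * turaev_genus D)"
proof -
  let ?F = "card (orbit (face_step D) ` \<Delta>)" and ?s = "card (A_state D) + card (B_state D)"
  have pos: "card (cut_space G) * card (bicycle_space G) > 0"
  proof -
    have "finite (bicycle_space G)" "finite (cut_space G)"
      using finite_cut_space[OF finite_edges_G] by (simp_all add: bicycle_space_def)
    then show ?thesis
      using additive_subgroup_zero[OF additive_subgroup_cut_space, of G]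
        additive_subgroup_zero[OF additive_subgroup_bicycle_space, of G]
      by (auto simp: card_gt_0_iff)
  qed
  have "real (2 ^ ?s * 2 ^ card (edges G))
      = real (card (cut_space G) * card (bicycle_space G) * 2 ^ ?F)"
    using card_state_functions_cut_space card_state_functions by simp
  then have "(2 :: real) ^ card (edges G) / (real (card (cut_space G)) * real (card (bicycle_space G)))
      = 2 ^ ?F / 2 ^ ?s"
    using pos by (simp add: field_simps)
  also have "\<dots> = 2 powr (real ?F - real ?s)"
    by (simp add: powr_diff powr_add powr_realpow power_add)
  \<comment> \<open>Four darts per crossing and two per edge give twice as many edges as crossings,
    so Euler's formula makes \<open>?F\<close> the number of crossings plus twice the number of
    crossing components. Each crossingless circle adds 2 to 2k and 1 to each of \<open>s_A\<close>
    and \<open>s_B\<close>, and cancels.\<close>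
  also have "real ?F - real ?s = 2 * turaev_genus D"
    using euler card_darts_opp card_darts_rot
    by (simp add: turaev_genus_def num_components_def s_A_def s_B_def)
  finally show ?thesis by (simp add: bicycle_weight_def)
qed

end

text \<open>The weight depends on \<open>G\<close> alone, so this contains the independence of the
  genus from the diagram \<open>D\<close>.\<close>

lemma decomposition_graph_bicycle_weight:
  assumes "has_decomposition_graph D G"
  shows "multigraph G" "bicycle_weight G = 2 powr (2 * turaev_genus D)"
proof -
  interpret spherical_diagram D
    using assms by unfold_locales (simp add: has_decomposition_graph_def)
  have iso: "isomorphic (alternating_decomposition_graph D) G"
    using assms by (simp add: has_decomposition_graph_def)
  show "multigraph G" by (rule multigraph_isomorphic[OF multigraph_G iso])
  show "bicycle_weight G = 2 powr (2 * turaev_genus D)"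
    using bicycle_weight_isomorphic[OF multigraph_G iso] bicycle_weight_G by simp
qed

lemma graph_turaev_genus_bicycle_weight:
  assumes "is_alternating_decomposition_graph G"
  shows "multigraph G" "bicycle_weight G = 2 powr (2 * graph_turaev_genus G)"
proof -
  have "has_decomposition_graph (SOME D. has_decomposition_graph D G) G"
    using assms unfolding is_alternating_decomposition_graph_def by (rule someI_ex)
  then show "multigraph G" "bicycle_weight G = 2 powr (2 * graph_turaev_genus G)"
    using decomposition_graph_bicycle_weight unfolding graph_turaev_genus_def by blast+
qed

theorem proposition3p11:
  fixes G1 :: "('v, 'e) mgraph" and G2 :: "('w, 'f) mgraph"
  assumes "is_alternating_decomposition_graph G1"
    and "is_alternating_decomposition_graph G2"
    and "doubled_path_equivalent G1 G2"
  shows "graph_turaev_genus G1 = graph_turaev_genus G2"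
proof -
  have "bicycle_weight G1 = bicycle_weight G2"
    by (rule doubled_path_equivalent_bicycle_weight
        [OF graph_turaev_genus_bicycle_weight(1)[OF assms(1)] assms(3)])
  then show ?thesis
    unfolding graph_turaev_genus_bicycle_weight(2)[OF assms(1)]
      graph_turaev_genus_bicycle_weight(2)[OF assms(2)] by (simp add: powr_inj)
qed

end
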